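(* There exists a countable, finitely branching and acyclic MDP $\mathcal{M}$ with integer transition rewards and initial state $s_0$, whose step counter is implicit in the state, such that $s_0$ is almost surely winning for $\mathit{TP}_{\liminf\ge 0}=\{\rho\mid \liminf_{n\to\infty}\sum_{j=0}^{n-1} r(e_j)\ge 0\}$, i.e., there is a strategy $\hat\sigma$ with $\mathcal{P}_{\mathcal{M},s_0,\hat\sigma}(\mathit{TP}_{\liminf\ge 0})=1$, but every finite-memory randomized (FR) strategy $\sigma$ satisfies $\mathcal{P}_{\mathcal{M},s_0,\sigma}(\mathit{TP}_{\liminf\ge 0})=0$. In particular, almost surely winning strategies for $\mathit{TP}_{\liminf\ge 0}$, when they exist, cannot in general be chosen $k$-bit Markov, for any $k\in\mathbb{N}$, in countable MDPs.
   Context: An MDP has a countable set of states partitioned into controlled and random states, a transition relation (every state has a successor), fixed probability distributions over successors at random states, and real rewards on transitions; runs are $s_0e_0s_1e_1\dots$ with transitions $e_j$. It is finitely branching if each state has finitely many successors and acyclic if its transition graph has no directed cycle. The step counter is implicit in the state if for every state $s$ all finite paths from $s_0$ to $s$ have the same length. A strategy assigns to each finite partial run ending in a controlled state a distribution over successors, inducing a probability measure $\mathcal{P}_{\mathcal{M},s_0,\sigma}$ on runs. FR strategies are those implementable with a finite set of memory modes and (possibly randomized) memory updates and choices depending on the current mode and state. A $k$-bit Markov strategy bases its choices on the current state, the number of steps taken so far, and $k$ bits of general-purpose memory. *)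

theory Defs
  imports "HOL-Probability.Probability"
begin

section \<open>Countable Markov decision processes with transition rewards\<close>

record 's mdp =
  ctrl :: "'s set"
  rand :: "'s set"
  edges :: "('s \<times> 's) set"
  tprob :: "'s \<Rightarrow> 's pmf"
  reward :: "'s \<times> 's \<Rightarrow> real"

definition states :: "('s, 'x) mdp_scheme \<Rightarrow> 's set" where
  "states M = ctrl M \<union> rand M"

definition succs :: "('s, 'x) mdp_scheme \<Rightarrow> 's \<Rightarrow> 's set" where
  "succs M s = edges M `` {s}"

locale MDP =
  fixes M :: "('s, 'x) mdp_scheme"
  assumes countable_states: "countable (states M)"
    and disjoint: "ctrl M \<inter> rand M = {}"
    and edges_subset: "edges M \<subseteq> states M \<times> states M"
    and succs_nonempty: "s \<in> states M \<Longrightarrow> succs M s \<noteq> {}"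
    and tprob_succs: "s \<in> rand M \<Longrightarrow> set_pmf (tprob M s) \<subseteq> succs M s"

definition finitely_branching :: "('s, 'x) mdp_scheme \<Rightarrow> bool" where
  "finitely_branching M \<longleftrightarrow> (\<forall>s \<in> states M. finite (succs M s))"

definition acyclic_mdp :: "('s, 'x) mdp_scheme \<Rightarrow> bool" where
  "acyclic_mdp M \<longleftrightarrow> acyclic (edges M)"

definition integer_rewards :: "('s, 'x) mdp_scheme \<Rightarrow> bool" where
  "integer_rewards M \<longleftrightarrow> (\<forall>e \<in> edges M. reward M e \<in> \<int>)"

text \<open>A pair is in the relational power of exponent n iff a path with n transitions joins it.\<close>

definition step_counter_implicit :: "('s, 'x) mdp_scheme \<Rightarrow> 's \<Rightarrow> bool" where
  "step_counter_implicit M s0 \<longleftrightarrow>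
     (\<forall>s \<in> states M. \<forall>m n. (s0, s) \<in> edges M ^^ m \<and> (s0, s) \<in> edges M ^^ n \<longrightarrow> m = n)"


section \<open>Strategies and the induced probability measure\<close>

text \<open>Two states are joined by at most one transition, so a (partial) run is represented by the
  sequence of states it visits.\<close>

definition partial_run :: "('s, 'x) mdp_scheme \<Rightarrow> 's list \<Rightarrow> bool" where
  "partial_run M h \<longleftrightarrow>
     h \<noteq> [] \<and> set h \<subseteq> states M \<and> successively (\<lambda>s t. (s, t) \<in> edges M) h"

text \<open>A strategy is a total function on lists; its values on lists other than partial runs ending
  in a controlled state are irrelevant.\<close>

definition strategy :: "('s, 'x) mdp_scheme \<Rightarrow> ('s list \<Rightarrow> 's pmf) \<Rightarrow> bool" where
  "strategy M \<sigma> \<longleftrightarrow>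
     (\<forall>h. partial_run M h \<and> last h \<in> ctrl M \<longrightarrow> set_pmf (\<sigma> h) \<subseteq> succs M (last h))"

definition next_dist :: "('s, 'x) mdp_scheme \<Rightarrow> 's \<Rightarrow> ('s list \<Rightarrow> 's pmf) \<Rightarrow> 's list \<Rightarrow> 's pmf" where
  "next_dist M s0 \<sigma> h =
     (if h = [] then return_pmf s0
      else if last h \<in> ctrl M then \<sigma> h
      else tprob M (last h))"

abbreviation run_kernel ::
  "('s, 'x) mdp_scheme \<Rightarrow> 's \<Rightarrow> ('s list \<Rightarrow> 's pmf) \<Rightarrow> nat \<Rightarrow> (nat \<Rightarrow> 's) \<Rightarrow> 's measure" where
  "run_kernel M s0 \<sigma> \<equiv> (\<lambda>n \<omega>. measure_pmf (next_dist M s0 \<sigma> (map \<omega> [0..<n])))"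

text \<open>The measure on infinite state sequences given by the Ionescu-Tulcea theorem: the state at
  position n is drawn from the distribution determined by the states at positions below n.
  The side conditions of the theorem hold for countable state types, see below.\<close>

definition run_measure ::
  "('s::countable, 'x) mdp_scheme \<Rightarrow> 's \<Rightarrow> ('s list \<Rightarrow> 's pmf) \<Rightarrow> (nat \<Rightarrow> 's) measure" where
  "run_measure M s0 \<sigma> =
     projective_family.lim UNIV
       (Ionescu_Tulcea.CI (run_kernel M s0 \<sigma>) (\<lambda>_. count_space UNIV))
       (\<lambda>_. count_space UNIV)"

definition TP_liminf_ge_0 :: "('s, 'x) mdp_scheme \<Rightarrow> (nat \<Rightarrow> 's) set" where
  "TP_liminf_ge_0 M =
     {\<omega>. liminf (\<lambda>n. ereal (\<Sum>j<n. reward M (\<omega> j, \<omega> (Suc j)))) \<ge> 0}"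


section \<open>Memory-based strategies\<close>

text \<open>One step of a memory-based strategy with set of modes Q goes from a pair (mode, state) to a
  distribution over such pairs; the memory update and the choice of the successor may be
  randomized and correlated, but at random states the successor must follow the MDP.\<close>

definition memory_structure ::
  "('s, 'x) mdp_scheme \<Rightarrow> 'm set \<Rightarrow> ('m \<times> 's \<Rightarrow> ('m \<times> 's) pmf) \<Rightarrow> bool" where
  "memory_structure M Q \<tau> \<longleftrightarrow>
     (\<forall>m \<in> Q.
        (\<forall>s \<in> ctrl M. set_pmf (\<tau> (m, s)) \<subseteq> Q \<times> succs M s) \<and>
        (\<forall>s \<in> rand M. set_pmf (\<tau> (m, s)) \<subseteq> Q \<times> UNIV \<and> map_pmf snd (\<tau> (m, s)) = tprob M s))"

text \<open>The first n steps of the Markov chain with kernel K started in x.\<close>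

primrec chain_prefix :: "('c \<Rightarrow> 'c pmf) \<Rightarrow> 'c \<Rightarrow> nat \<Rightarrow> 'c list pmf" where
  "chain_prefix K x 0 = return_pmf [x]"
| "chain_prefix K x (Suc n) =
     bind_pmf (chain_prefix K x n) (\<lambda>xs. map_pmf (\<lambda>y. xs @ [y]) (K (last xs)))"

text \<open>The strategy induced by a memory structure: after the partial run h, the mode is distributed
  according to the Markov chain on pairs (mode, state), conditioned on the projection to states
  being h. The condition is meaningful exactly for those h that the chain produces with positive
  probability; a strategy is left unconstrained elsewhere.\<close>

definition induced_choice ::
  "('m \<times> 's \<Rightarrow> ('m \<times> 's) pmf) \<Rightarrow> 'm \<Rightarrow> 's \<Rightarrow> 's list \<Rightarrow> 's pmf" where
  "induced_choice \<tau> m0 s0 h =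
     bind_pmf (cond_pmf (chain_prefix \<tau> (m0, s0) (length h - 1)) {xs. map snd xs = h})
       (\<lambda>xs. map_pmf snd (\<tau> (last xs)))"

definition implemented_by ::
  "('s, 'x) mdp_scheme \<Rightarrow> 's \<Rightarrow> ('m \<times> 's \<Rightarrow> ('m \<times> 's) pmf) \<Rightarrow> 'm \<Rightarrow> ('s list \<Rightarrow> 's pmf) \<Rightarrow> bool" where
  "implemented_by M s0 \<tau> m0 \<sigma> \<longleftrightarrow>
     (\<forall>h. partial_run M h \<and> last h \<in> ctrl M \<and>
          (\<exists>xs \<in> set_pmf (chain_prefix \<tau> (m0, s0) (length h - 1)). map snd xs = h) \<longrightarrow>
          \<sigma> h = induced_choice \<tau> m0 s0 h)"

text \<open>Only the number of modes matters, so finite memories are taken to be sets of naturals.\<close>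

definition FR_strategy :: "('s, 'x) mdp_scheme \<Rightarrow> 's \<Rightarrow> ('s list \<Rightarrow> 's pmf) \<Rightarrow> bool" where
  "FR_strategy M s0 \<sigma> \<longleftrightarrow>
     strategy M \<sigma> \<and>
     (\<exists>(Q :: nat set) \<tau> m0. finite Q \<and> m0 \<in> Q \<and> memory_structure M Q \<tau> \<and>
        implemented_by M s0 \<tau> m0 \<sigma>)"

text \<open>The modes of a k-bit Markov strategy are pairs of a step counter and k bits; every step
  increments the counter, whereas the bits are updated freely.\<close>

definition kbit_Markov_strategy ::
  "nat \<Rightarrow> ('s, 'x) mdp_scheme \<Rightarrow> 's \<Rightarrow> ('s list \<Rightarrow> 's pmf) \<Rightarrow> bool" where
  "kbit_Markov_strategy k M s0 \<sigma> \<longleftrightarrow>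
     strategy M \<sigma> \<and>
     (\<exists>(\<tau> :: (nat \<times> bool list) \<times> 's \<Rightarrow> ((nat \<times> bool list) \<times> 's) pmf) b0.
        length b0 = k \<and>
        memory_structure M (UNIV \<times> {b. length b = k}) \<tau> \<and>
        (\<forall>n b. length b = k \<longrightarrow>
          (\<forall>s \<in> states M. \<forall>((n', b'), s') \<in> set_pmf (\<tau> ((n, b), s)). n' = Suc n)) \<and>
        implemented_by M s0 \<tau> (0, b0) \<sigma>)"


section \<open>Well-definedness of the probability of the objective\<close>

lemma measurable_map_prefix:
  fixes xs :: "nat list"
  assumes "set xs \<subseteq> I"
  shows "(\<lambda>\<omega>. map \<omega> xs) \<in>
    measurable (PiM I (\<lambda>_. count_space (UNIV :: 's::countable set))) (count_space UNIV)"
  using assms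
proof (induction xs)
  case (Cons i xs)
  have "(\<lambda>\<omega>. \<omega> i # map \<omega> xs) \<in>
      measurable (PiM I (\<lambda>_. count_space (UNIV :: 's set))) (count_space UNIV)"
  proof (rule measurable_compose_countable[where f="\<lambda>a \<omega>. a # map \<omega> xs"])
    show "(\<lambda>\<omega>. a # map \<omega> xs) \<in>
        measurable (PiM I (\<lambda>_. count_space (UNIV :: 's set))) (count_space UNIV)" for a :: 's
      using measurable_compose[OF Cons.IH, of "\<lambda>ys. a # ys" "count_space UNIV"] Cons.prems by simp
    show "(\<lambda>\<omega>. \<omega> i) \<in>
        measurable (PiM I (\<lambda>_. count_space (UNIV :: 's set))) (count_space UNIV)"
      using Cons.prems by (intro measurable_component_singleton) auto
  qed
  then show ?case by simp
qed simp

lemma Ionescu_Tulcea_run_kernel: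
  fixes M :: "('s::countable, 'x) mdp_scheme"
  shows "Ionescu_Tulcea (run_kernel M s0 \<sigma>) (\<lambda>_. count_space UNIV)"
proof
  fix n
  have "(\<lambda>h. measure_pmf (next_dist M s0 \<sigma> h)) \<in>
      measurable (count_space UNIV) (subprob_algebra (count_space UNIV))"
    by (simp add: space_subprob_algebra prob_space_imp_subprob_space measure_pmf.prob_space_axioms)
  from measurable_compose[OF measurable_map_prefix this, of "[0..<n]" "{0..<n}"]
  show "run_kernel M s0 \<sigma> n \<in>
      measurable (PiM {0..<n} (\<lambda>_. count_space UNIV)) (subprob_algebra (count_space UNIV))"
    by simp
qed

lemma sets_run_measure [measurable_cong]:
  fixes M :: "('s::countable, 'x) mdp_scheme"
  shows "sets (run_measure M s0 \<sigma>) = sets (PiM UNIV (\<lambda>_. count_space UNIV))"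
proof -
  interpret Ionescu_Tulcea "run_kernel M s0 \<sigma>" "\<lambda>_. count_space UNIV"
    by (rule Ionescu_Tulcea_run_kernel)
  show ?thesis
    unfolding run_measure_def by (rule PF.sets_lim)
qed

lemma space_run_measure: "space (run_measure M s0 \<sigma>) = UNIV"
  using sets_eq_imp_space_eq[OF sets_run_measure] by (auto simp: space_PiM)

lemma emeasure_run_measure_cylinder:
  fixes M :: "('s::countable, 'x) mdp_scheme"
  shows "emeasure (run_measure M s0 \<sigma>) {\<omega>. map \<omega> [0..<length h] = h} =
    (\<Prod>i<length h. ennreal (pmf (next_dist M s0 \<sigma> (take i h)) (h ! i)))"
proof -
  let ?N = "\<lambda>_::nat. count_space (UNIV :: 's set)"
  let ?A = "\<lambda>h::'s list. {\<omega> \<in> space (PiM {0..<length h} ?N). map \<omega> [0..<length h] = h}"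
  interpret Ionescu_Tulcea "run_kernel M s0 \<sigma>" ?N
    by (rule Ionescu_Tulcea_run_kernel)
  have sets_A: "?A h \<in> sets (PiM {0..<length h} ?N)" for h :: "'s list"
    using measurable_sets[OF measurable_map_prefix[of "[0..<length h]" "{0..<length h}"], of "{h}"]
    by (simp add: vimage_def Int_def conj_commute)
  have C_A: "emeasure (C 0 (length h) (\<lambda>_. undefined)) (?A h) =
      (\<Prod>i<length h. ennreal (pmf (next_dist M s0 \<sigma> (take i h)) (h ! i)))" for h :: "'s list"
  proof (induction h rule: rev_induct)
    case Nil
    then show ?case by (simp add: PiM_empty space_PiM)
  next
    case (snoc s g)
    let ?n = "length g" and ?u = "\<lambda>_::nat. undefined :: 's"
    have u: "?u \<in> space (PiM {0..<0} ?N)" by (simp add: space_PiM)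
    have sp: "space (C 0 ?n ?u) = space (PiM {0..<?n} ?N)"
      using space_C[OF u, of ?n] by simp
    have st: "sets (C 0 ?n ?u) = sets (PiM {0..<?n} ?N)"
      using sets_C[OF u, of ?n] by simp
    have A: "?A (g @ [s]) \<in> sets (PiM {0..<Suc ?n} ?N)"
      using sets_A[of "g @ [s]"] by simp
    have eP_A: "emeasure (eP ?n \<omega>) (?A (g @ [s])) =
        ennreal (pmf (next_dist M s0 \<sigma> g) s) * indicator (?A g) \<omega>"
      if \<omega>: "\<omega> \<in> space (PiM {0..<?n} ?N)" for \<omega>
    proof -
      have "fun_upd \<omega> ?n -` ?A (g @ [s]) \<inter> space (?N ?n) =
          (if map \<omega> [0..<?n] = g then {s} else {})"
        using \<omega> by (auto simp: space_PiM PiE_iff extensional_def map_fun_upd split: if_splits)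
      then show ?thesis
        using emeasure_eP[OF \<omega> A] \<omega> by (auto simp: emeasure_pmf_single)
    qed
    have "emeasure (C 0 (length (g @ [s])) ?u) (?A (g @ [s])) =
        (\<integral>\<^sup>+ \<omega>. emeasure (eP ?n \<omega>) (?A (g @ [s])) \<partial>C 0 ?n ?u)"
      using measurable_eP[of ?n] A st
      by (simp del: length_append upt_Suc add: length_append_singleton,
          subst emeasure_bind[where N="PiM {0..<Suc ?n} ?N"])
         (auto simp: sp space_PiM measurable_cong_sets[OF st refl])
    also have "\<dots> = (\<integral>\<^sup>+ \<omega>. ennreal (pmf (next_dist M s0 \<sigma> g) s) * indicator (?A g) \<omega> \<partial>C 0 ?n ?u)"
      by (intro nn_integral_cong eP_A) (simp add: sp)
    also have "\<dots> = ennreal (pmf (next_dist M s0 \<sigma> g) s) * emeasure (C 0 ?n ?u) (?A g)"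
      by (rule nn_integral_cmult_indicator) (simp only: st sets_A)
    also have "\<dots> = (\<Prod>i<length (g @ [s]).
        ennreal (pmf (next_dist M s0 \<sigma> (take i (g @ [s]))) ((g @ [s]) ! i)))"
      by (subst snoc.IH) (simp add: nth_append mult.commute)
    finally show ?case .
  qed
  have "{\<omega>. map \<omega> [0..<length h] = h} = PF.emb UNIV {0..<length h} (?A h)"
  proof -
    have *: "map (restrict \<omega> {0..<length h}) [0..<length h] = map \<omega> [0..<length h]" for \<omega> :: "nat \<Rightarrow> 's"
      by simp
    show ?thesis
      unfolding prod_emb_def
      by (auto simp: space_PiM PiE_iff * simp del: restrict_apply map_eq_conv)
  qed
  then show ?thesis
    using lim[OF _ sets_A[of h]] emeasure_CI[OF order_refl sets_A[of h]] C_A[of h]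
      sets.sets_into_space[OF sets_A[of h]]
    by (simp add: run_measure_def prod_emb_id space_PiM)
qed

lemma prob_space_run_measure: "prob_space (run_measure M s0 \<sigma>)"
proof
  show "emeasure (run_measure M s0 \<sigma>) (space (run_measure M s0 \<sigma>)) = 1"
    using emeasure_run_measure_cylinder[of M s0 \<sigma> "[]"] by (simp add: space_run_measure)
qed

lemma sets_TP_liminf_ge_0:
  fixes M :: "('s::countable, 'x) mdp_scheme"
  shows "TP_liminf_ge_0 M \<in> sets (run_measure M s0 \<sigma>)"
proof -
  have *: "(\<lambda>\<omega>. reward M (\<omega> j, \<omega> (Suc j))) \<in> borel_measurable (run_measure M s0 \<sigma>)" for j
  proof -
    have "(\<lambda>\<omega>. map \<omega> [j, Suc j]) \<in> measurable (run_measure M s0 \<sigma>) (count_space UNIV)"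
      using measurable_map_prefix[of "[j, Suc j]" UNIV] sets_run_measure
      by (simp cong: measurable_cong_sets)
    from measurable_compose[OF this, of "\<lambda>ys. reward M (ys ! 0, ys ! 1)" borel]
    show ?thesis by simp
  qed
  have "(\<lambda>\<omega>. liminf (\<lambda>n. ereal (\<Sum>j<n. reward M (\<omega> j, \<omega> (Suc j))))) \<in>
      borel_measurable (run_measure M s0 \<sigma>)"
    using * by measurable
  then have "{\<omega> \<in> space (run_measure M s0 \<sigma>).
      0 \<le> liminf (\<lambda>n. ereal (\<Sum>j<n. reward M (\<omega> j, \<omega> (Suc j))))} \<in> sets (run_measure M s0 \<sigma>)"
    by measurable
  then show ?thesis
    by (simp add: TP_liminf_ge_0_def space_run_measure)
qed

end

theory Submission
  imports Defs
begin

text \<open>Round n of the game hands out a random amount i, forgets it in the state, and lets the player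
  pay an amount j. Paying more than i makes the accumulated reward negative; paying j is followed by
  a temporary loss, which also makes it negative, with a probability r ^ (j + 1) that decreases in j.
  The amounts range over 0, ..., N with probabilities of order r ^ (N - i). Paying j = i, which the
  player can do by remembering i, costs at most (N + 1) * r ^ (N + 1). With at most N
  modes some amount i is paid with probability at most 1 / 2 in every mode, and receiving it costs of
  order r ^ (N - i) * r ^ i = r ^ N. The parameters N and r vary with the round such that the first
  costs are summable and the second ones, for rounds with N above any bound, are not. By Borel-Cantelli
  the matching player loses only finitely many rounds, and the conditional bound in each round makes
  a player with bounded memory lose infinitely many.\<close>


section \<open>Probabilities of two-stage experiments\<close>

text \<open>Total probability over the first stage, for an event that can only happen after an
  outcome in \<open>A\<close>. Rounds are chained with \<open>A\<close> saying that all earlier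
  rounds were good.\<close>

lemma prob_bind_upper:
  fixes p :: "'a pmf" and f :: "'a \<Rightarrow> 'b pmf"
  assumes "0 \<le> c"
    and in_A: "\<And>x. x \<in> set_pmf p \<Longrightarrow> x \<in> A \<Longrightarrow> measure_pmf.prob (f x) E \<le> c"
    and not_in_A: "\<And>x. x \<in> set_pmf p \<Longrightarrow> x \<notin> A \<Longrightarrow> measure_pmf.prob (f x) E = 0"
  shows "measure_pmf.prob (bind_pmf p f) E \<le> measure_pmf.prob p A * c"
proof -
  have "emeasure (measure_pmf (bind_pmf p f)) E = (\<integral>\<^sup>+x. emeasure (measure_pmf (f x)) E \<partial>p)"
    by simp
  also have "\<dots> \<le> (\<integral>\<^sup>+x. ennreal c * indicator A x \<partial>p)"
    by (intro nn_integral_mono_AE AE_pmfI)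
       (use in_A not_in_A in \<open>auto simp: measure_pmf.emeasure_eq_measure indicator_def
          intro!: ennreal_leI\<close>)
  also have "\<dots> = ennreal (measure_pmf.prob p A * c)"
    using \<open>0 \<le> c\<close>
    by (simp add: nn_integral_cmult measure_pmf.emeasure_eq_measure mult.commute
        flip: ennreal_mult)
  finally show ?thesis
    using \<open>0 \<le> c\<close> by (simp add: measure_pmf.emeasure_eq_measure)
qed

lemma prob_bind_lower:
  fixes p :: "'a pmf" and f :: "'a \<Rightarrow> 'b pmf"
  assumes "0 \<le> c"
    and in_A: "\<And>x. x \<in> set_pmf p \<Longrightarrow> x \<in> A \<Longrightarrow> c \<le> measure_pmf.prob (f x) E"
  shows "measure_pmf.prob p A * c \<le> measure_pmf.prob (bind_pmf p f) E"
proof -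
  have "ennreal (measure_pmf.prob p A * c) = (\<integral>\<^sup>+x. ennreal c * indicator A x \<partial>p)"
    using \<open>0 \<le> c\<close>
    by (simp add: nn_integral_cmult measure_pmf.emeasure_eq_measure mult.commute
        flip: ennreal_mult)
  also have "\<dots> \<le> (\<integral>\<^sup>+x. emeasure (measure_pmf (f x)) E \<partial>p)"
    by (intro nn_integral_mono_AE AE_pmfI)
       (use in_A in \<open>auto simp: measure_pmf.emeasure_eq_measure indicator_def
          intro!: ennreal_leI\<close>)
  also have "\<dots> = emeasure (measure_pmf (bind_pmf p f)) E"
    by simp
  finally show ?thesis
    by (simp add: measure_pmf.emeasure_eq_measure)
qed

text \<open>Disintegration along \<open>f\<close>: it undoes the conditioning on the history in
  \<open>induced_choice\<close>.\<close>

lemma bind_cond_pmf_fibres: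
  "bind_pmf (map_pmf f p) (\<lambda>y. cond_pmf p {x. f x = y}) = p"
proof (rule bind_cond_pmf_cancel)
  fix y x assume "y \<in> set_pmf (map_pmf f p)" "x \<in> set_pmf p" "f x = y"
  then show "measure_pmf.prob p {x. f x = y} = measure_pmf.prob (map_pmf f p) {y. f x = y}"
    by (auto simp: vimage_def eq_commute)
qed auto


section \<open>Finite prefixes of runs\<close>

text \<open>The prefix law is built as a \<open>pmf\<close>, so that finite-horizon events can be
  treated with the monad laws instead of in the infinite product.\<close>

primrec run_prefix ::
  "('s, 'x) mdp_scheme \<Rightarrow> 's \<Rightarrow> ('s list \<Rightarrow> 's pmf) \<Rightarrow> nat \<Rightarrow> 's list pmf" where
  "run_prefix M s0 \<sigma> 0 = return_pmf [s0]"
| "run_prefix M s0 \<sigma> (Suc n) =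
     bind_pmf (run_prefix M s0 \<sigma> n) (\<lambda>h. map_pmf (\<lambda>s. h @ [s]) (next_dist M s0 \<sigma> h))"

lemma length_run_prefix:
  "h \<in> set_pmf (run_prefix M s0 \<sigma> n) \<Longrightarrow> length h = Suc n"
  by (induction n arbitrary: h) auto

lemma pmf_run_prefix:
  "pmf (run_prefix M s0 \<sigma> n) h =
     (if length h = Suc n then \<Prod>i<length h. pmf (next_dist M s0 \<sigma> (take i h)) (h ! i) else 0)"
proof (induction n arbitrary: h)
  case 0
  show ?case
  proof (cases "length h = 1")
    case True
    then obtain s where "h = [s]" by (auto simp: length_Suc_conv)
    then show ?thesis by (auto simp: next_dist_def indicator_def)
  qed (auto simp: indicator_def)
next
  case (Suc n)
  show ?case
  proof (cases "length h = Suc (Suc n)")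
    case False
    then have "h \<notin> set_pmf (run_prefix M s0 \<sigma> (Suc n))"
      using length_run_prefix by metis
    then show ?thesis using False by (simp add: pmf_eq_0_set_pmf)
  next
    case True
    then obtain g s where h: "h = g @ [s]" and g: "length g = Suc n"
      by (metis length_append_singleton old.nat.inject rev_exhaust length_0_conv nat.distinct(1))
    \<comment> \<open>Only \<open>g\<close> extends to \<open>h\<close> by one state, so the mixture
      over prefixes reduces to a single term.\<close>
    have "pmf (map_pmf (\<lambda>s. g' @ [s]) (next_dist M s0 \<sigma> g')) h =
        pmf (next_dist M s0 \<sigma> g) s * indicator {g} g'" for g'
    proof (cases "g' = g")
      case True
      have "inj (\<lambda>s. g @ [s])" by (auto intro: injI)
      then show ?thesis
        using True pmf_map_inj'[of "\<lambda>s. g @ [s]" "next_dist M s0 \<sigma> g" s] h by simp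
    qed (auto simp: h pmf_eq_0_set_pmf)
    then have "pmf (run_prefix M s0 \<sigma> (Suc n)) h =
        pmf (run_prefix M s0 \<sigma> n) g * pmf (next_dist M s0 \<sigma> g) s"
      by (simp add: pmf_bind measure_pmf_single)
    then show ?thesis
      using g by (simp add: Suc.IH h nth_append)
  qed
qed

section \<open>The run measure and its finite prefixes\<close>

lemma measurable_map_run_measure:
  fixes M :: "('s::countable, 'x) mdp_scheme"
  shows "(\<lambda>\<omega>. map \<omega> ts) \<in> measurable (run_measure M s0 \<sigma>) (count_space UNIV)"
  using measurable_map_prefix[OF subset_UNIV, of ts]
  by (simp only: measurable_cong_sets[OF sets_run_measure refl])

text \<open>Lists over a countable type form a countable set, so singletons suffice; their
  probabilities are cylinder probabilities, given by the same product as for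
  \<open>run_prefix\<close>.\<close>

lemma distr_run_measure:
  fixes M :: "('s::countable, 'x) mdp_scheme"
  shows "distr (run_measure M s0 \<sigma>) (count_space UNIV) (\<lambda>\<omega>. map \<omega> [0..<Suc n]) =
    measure_pmf (run_prefix M s0 \<sigma> n)"
proof (rule measure_eqI_countable[where A=UNIV])
  have [measurable]: "(\<lambda>\<omega>. map \<omega> [0..<Suc n]) \<in> measurable (run_measure M s0 \<sigma>) (count_space UNIV)"
    by (rule measurable_map_run_measure)
  fix h :: "'s list"
  have "emeasure (distr (run_measure M s0 \<sigma>) (count_space UNIV) (\<lambda>\<omega>. map \<omega> [0..<Suc n])) {h} =
      emeasure (run_measure M s0 \<sigma>) {\<omega>. map \<omega> [0..<Suc n] = h}"
    by (subst emeasure_distr) (auto simp: space_run_measure vimage_def simp del: upt_Suc)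
  also have "\<dots> = ennreal (pmf (run_prefix M s0 \<sigma> n) h)"
  proof (cases "length h = Suc n")
    case True
    then show ?thesis
      using emeasure_run_measure_cylinder[of M s0 \<sigma> h]
      by (simp add: pmf_run_prefix prod_ennreal prod_nonneg flip: ennreal_mult del: upt_Suc)
  next
    case False
    then have "{\<omega>. map \<omega> [0..<Suc n] = h} = {}" by (auto simp del: upt_Suc)
    then show ?thesis using False by (simp add: pmf_run_prefix)
  qed
  finally show "emeasure (distr (run_measure M s0 \<sigma>) (count_space UNIV)
      (\<lambda>\<omega>. map \<omega> [0..<Suc n])) {h} = emeasure (measure_pmf (run_prefix M s0 \<sigma> n)) {h}"
    by (simp add: emeasure_pmf_single)
qed auto

lemma measurable_run_prefix:
  fixes M :: "('s::countable, 'x) mdp_scheme"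
  shows "{\<omega>. P (map \<omega> [0..<Suc n])} \<in> sets (run_measure M s0 \<sigma>)"
proof -
  have [measurable]: "(\<lambda>\<omega>. map \<omega> [0..<Suc n]) \<in> measurable (run_measure M s0 \<sigma>) (count_space UNIV)"
    by (rule measurable_map_run_measure)
  have "{\<omega> \<in> space (run_measure M s0 \<sigma>). P (map \<omega> [0..<Suc n])} \<in> sets (run_measure M s0 \<sigma>)"
    by measurable
  then show ?thesis by (simp add: space_run_measure del: upt_Suc)
qed

lemma measure_run_prefix:
  fixes M :: "('s::countable, 'x) mdp_scheme"
  shows "measure (run_measure M s0 \<sigma>) {\<omega>. P (map \<omega> [0..<Suc n])} =
    measure_pmf.prob (run_prefix M s0 \<sigma> n) {h. P h}"
proof -
  have "(\<lambda>\<omega>. map \<omega> [0..<Suc n]) \<in> measurable (run_measure M s0 \<sigma>) (count_space UNIV)"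
    by (rule measurable_map_run_measure)
  then show ?thesis
    unfolding distr_run_measure[symmetric]
    by (subst measure_distr) (auto simp: space_run_measure vimage_def simp del: upt_Suc)
qed

lemma AE_run_prefix:
  fixes M :: "('s::countable, 'x) mdp_scheme"
  shows "AE \<omega> in run_measure M s0 \<sigma>. map \<omega> [0..<Suc n] \<in> set_pmf (run_prefix M s0 \<sigma> n)"
proof -
  interpret prob_space "run_measure M s0 \<sigma>" by (rule prob_space_run_measure)
  have "prob {\<omega>. map \<omega> [0..<Suc n] \<in> set_pmf (run_prefix M s0 \<sigma> n)} = 1"
    using measure_run_prefix[of M s0 \<sigma> "\<lambda>h. h \<in> set_pmf (run_prefix M s0 \<sigma> n)" n]
      measure_pmf.prob_eq_1[of "set_pmf (run_prefix M s0 \<sigma> n)" "run_prefix M s0 \<sigma> n"]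
    by (simp add: AE_measure_pmf)
  from AE_prob_1[OF this] show ?thesis by simp
qed

lemma AE_run_step:
  fixes M :: "('s::countable, 'x) mdp_scheme"
  shows "AE \<omega> in run_measure M s0 \<sigma>.
    \<omega> 0 = s0 \<and> (\<forall>t. \<omega> (Suc t) \<in> set_pmf (next_dist M s0 \<sigma> (map \<omega> [0..<Suc t])))"
proof -
  have "AE \<omega> in run_measure M s0 \<sigma>.
      \<forall>t. map \<omega> [0..<Suc t] \<in> set_pmf (run_prefix M s0 \<sigma> t)"
    by (intro AE_all_countable[THEN iffD2] allI AE_run_prefix)
  then show ?thesis
  proof eventually_elim
    case (elim \<omega>)
    have "\<omega> (Suc t) \<in> set_pmf (next_dist M s0 \<sigma> (map \<omega> [0..<Suc t]))" for t
      using elim[rule_format, of "Suc t"] upt_Suc_append[of 0 "Suc t"]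
      by (auto simp del: upt_Suc)
    then show ?case using elim[rule_format, of 0] by simp
  qed
qed


section \<open>Implemented strategies and their Markov chains\<close>

lemma length_chain_prefix:
  "xs \<in> set_pmf (chain_prefix K x n) \<Longrightarrow> length xs = Suc n"
  by (induction n arbitrary: xs) auto

lemma successively_snoc:
  "xs \<noteq> [] \<Longrightarrow> successively P (xs @ [y]) \<longleftrightarrow> successively P xs \<and> P (last xs) y"
  by (simp add: successively_append_iff)

context MDP
begin

lemma memory_step:
  assumes "memory_structure M Q \<tau>" "m \<in> Q" "s \<in> states M" "(m', s') \<in> set_pmf (\<tau> (m, s))"
  shows "m' \<in> Q" "(s, s') \<in> edges M"
proof -
  consider "s \<in> ctrl M" | "s \<in> rand M" using assms(3) by (auto simp: states_def)
  then have "m' \<in> Q \<and> s' \<in> succs M s"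
  proof cases
    case 1
    then show ?thesis using assms by (fastforce simp: memory_structure_def)
  next
    case 2
    then have *: "set_pmf (\<tau> (m, s)) \<subseteq> Q \<times> UNIV" "map_pmf snd (\<tau> (m, s)) = tprob M s"
      using assms by (auto simp: memory_structure_def)
    from * have "s' \<in> set_pmf (tprob M s)"
      using assms(4) by (force simp flip: *(2))
    then show ?thesis using 2 tprob_succs * assms(4) by blast
  qed
  then show "m' \<in> Q" "(s, s') \<in> edges M" by (auto simp: succs_def)
qed

lemma partial_run_chain_prefix:
  assumes "memory_structure M Q \<tau>" "m0 \<in> Q" "s0 \<in> states M"
    and "xs \<in> set_pmf (chain_prefix \<tau> (m0, s0) n)"
  shows "partial_run M (map snd xs) \<and> fst (last xs) \<in> Q"
  using assms(4)
proof (induction n arbitrary: xs)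
  case 0
  then show ?case using assms by (simp add: partial_run_def)
next
  case (Suc n)
  then obtain ys y where ys: "ys \<in> set_pmf (chain_prefix \<tau> (m0, s0) n)"
    "y \<in> set_pmf (\<tau> (last ys))" "xs = ys @ [y]"
    by auto
  have ne: "ys \<noteq> []" using length_chain_prefix[OF ys(1)] by auto
  from Suc.IH[OF ys(1)] have IH: "partial_run M (map snd ys)" "fst (last ys) \<in> Q" by auto
  have "snd (last ys) \<in> states M"
    using IH ne by (auto simp: partial_run_def)
  then have "fst y \<in> Q" "(snd (last ys), snd y) \<in> edges M"
    using memory_step[OF assms(1) IH(2), of "snd (last ys)" "fst y" "snd y"] ys(2) by auto
  then show ?case
    using IH ne edges_subset ys(3)
    by (auto simp: partial_run_def successively_snoc last_map)
qed

text \<open>At controlled states the strategy mixes the choices of the modes with exactly the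
  conditional law of the mode given the history; at random states the state marginal is the same in
  every mode. Memory strategies can thus be analysed as Markov chains on pairs.\<close>

lemma run_prefix_implemented_by:
  assumes \<tau>: "memory_structure M Q \<tau>" and m0: "m0 \<in> Q" and s0: "s0 \<in> states M"
    and impl: "implemented_by M s0 \<tau> m0 \<sigma>"
  shows "run_prefix M s0 \<sigma> n = map_pmf (map snd) (chain_prefix \<tau> (m0, s0) n)"
proof (induction n)
  case 0
  show ?case by simp
next
  case (Suc n)
  let ?C = "chain_prefix \<tau> (m0, s0) n"
  \<comment> \<open>Only histories of positive probability are covered: elsewhere
    \<open>implemented_by\<close> leaves \<open>\<sigma>\<close> free.\<close>
  have next_eq: "next_dist M s0 \<sigma> h =
      bind_pmf (cond_pmf ?C {xs. map snd xs = h}) (\<lambda>xs. map_pmf snd (\<tau> (last xs)))"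
    if h: "h \<in> set_pmf (map_pmf (map snd) ?C)" for h
  proof -
    from h obtain xs where xs: "xs \<in> set_pmf ?C" "map snd xs = h" by auto
    have len: "length h = Suc n" using xs length_chain_prefix by fastforce
    have run: "partial_run M h"
      using partial_run_chain_prefix[OF \<tau> m0 s0 xs(1)] xs(2) by simp
    have ne_fibre: "set_pmf ?C \<inter> {xs. map snd xs = h} \<noteq> {}" using xs by auto
    have ne: "h \<noteq> []" and "last h \<in> states M" using run by (auto simp: partial_run_def)
    show ?thesis
    proof (cases "last h \<in> ctrl M")
      case True
      then have "\<sigma> h = induced_choice \<tau> m0 s0 h"
        using impl run xs len by (force simp: implemented_by_def)
      then show ?thesis
        using True ne len by (simp add: next_dist_def induced_choice_def)
    next
      case False
      then have rand: "last h \<in> rand M" using \<open>last h \<in> states M\<close> by (simp add: states_def)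
      have "bind_pmf (cond_pmf ?C {xs. map snd xs = h}) (\<lambda>xs. map_pmf snd (\<tau> (last xs))) =
          bind_pmf (cond_pmf ?C {xs. map snd xs = h}) (\<lambda>_. tprob M (last h))"
      proof (rule bind_pmf_cong[OF refl])
        fix ys assume "ys \<in> set_pmf (cond_pmf ?C {xs. map snd xs = h})"
        then have ys: "ys \<in> set_pmf ?C" "map snd ys = h"
          using set_cond_pmf[OF ne_fibre] by auto
        have "last ys = (fst (last ys), last h)"
          using ys ne last_map[of ys snd] by (cases "ys = []") (auto simp: prod_eq_iff)
        then show "map_pmf snd (\<tau> (last ys)) = tprob M (last h)"
          using partial_run_chain_prefix[OF \<tau> m0 s0 ys(1)] \<tau> rand
          unfolding memory_structure_def by metis
      qed
      then show ?thesis using False ne by (simp add: next_dist_def)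
    qed
  qed
  have "run_prefix M s0 \<sigma> (Suc n) =
      bind_pmf (map_pmf (map snd) ?C) (\<lambda>h. map_pmf (\<lambda>s. h @ [s])
        (bind_pmf (cond_pmf ?C {xs. map snd xs = h}) (\<lambda>xs. map_pmf snd (\<tau> (last xs)))))"
    unfolding run_prefix.simps Suc.IH
    by (intro bind_pmf_cong refl) (simp only: next_eq)
  \<comment> \<open>Every \<open>xs\<close> in the fibre projects to \<open>h\<close>, so appending
    a state to \<open>h\<close> is projecting an extension of \<open>xs\<close>.\<close>
  also have "\<dots> = bind_pmf (map_pmf (map snd) ?C) (\<lambda>h. bind_pmf (cond_pmf ?C {xs. map snd xs = h})
      (\<lambda>xs. map_pmf (\<lambda>y. map snd (xs @ [y])) (\<tau> (last xs))))"
  proof (intro bind_pmf_cong refl)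
    fix h assume h: "h \<in> set_pmf (map_pmf (map snd) ?C)"
    then have "set_pmf ?C \<inter> {xs. map snd xs = h} \<noteq> {}" by auto
    then show "map_pmf (\<lambda>s. h @ [s])
        (bind_pmf (cond_pmf ?C {xs. map snd xs = h}) (\<lambda>xs. map_pmf snd (\<tau> (last xs)))) =
      bind_pmf (cond_pmf ?C {xs. map snd xs = h})
        (\<lambda>xs. map_pmf (\<lambda>y. map snd (xs @ [y])) (\<tau> (last xs)))"
      unfolding map_bind_pmf
      by (intro bind_pmf_cong refl) (auto simp: set_cond_pmf pmf.map_comp o_def)
  qed
  also have "\<dots> = bind_pmf ?C (\<lambda>xs. map_pmf (\<lambda>y. map snd (xs @ [y])) (\<tau> (last xs)))"
    by (subst bind_assoc_pmf[symmetric], subst bind_cond_pmf_fibres) (rule refl)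
  also have "\<dots> = map_pmf (map snd) (chain_prefix \<tau> (m0, s0) (Suc n))"
    by (simp add: map_bind_pmf pmf.map_comp o_def)
  finally show ?case .
qed

lemma set_next_dist_succs:
  assumes "strategy M \<sigma>" "partial_run M h"
  shows "set_pmf (next_dist M s0 \<sigma> h) \<subseteq> succs M (last h)"
proof -
  have "h \<noteq> []" "last h \<in> states M" using assms(2) by (auto simp: partial_run_def)
  then show ?thesis
    using assms tprob_succs[of "last h"] by (auto simp: next_dist_def strategy_def states_def)
qed

lemma partial_run_run_prefix:
  assumes "strategy M \<sigma>" "s0 \<in> states M" "h \<in> set_pmf (run_prefix M s0 \<sigma> n)"
  shows "partial_run M h \<and> (s0, last h) \<in> edges M ^^ n"
  using assms(3)
proof (induction n arbitrary: h)
  case 0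
  then show ?case using assms(2) by (simp add: partial_run_def)
next
  case (Suc n)
  then obtain g s where g: "g \<in> set_pmf (run_prefix M s0 \<sigma> n)"
    "s \<in> set_pmf (next_dist M s0 \<sigma> g)" "h = g @ [s]"
    by auto
  then have "(last g, s) \<in> edges M"
    using set_next_dist_succs[OF assms(1)] Suc.IH by (auto simp: succs_def)
  then show ?case
    using Suc.IH[OF g(1)] edges_subset g(3) by (auto simp: partial_run_def successively_snoc)
qed

end

text \<open>The measure lives on all state sequences; this confines it to paths, on which the payoff
  can be computed.\<close>

lemma AE_run_path:
  fixes M :: "('s::countable, 'x) mdp_scheme"
  assumes "MDP M" "strategy M \<sigma>" "s0 \<in> states M"
  shows "AE \<omega> in run_measure M s0 \<sigma>. \<omega> 0 = s0 \<and> (\<forall>t. (\<omega> t, \<omega> (Suc t)) \<in> edges M)"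
proof -
  interpret MDP M by fact
  have "AE \<omega> in run_measure M s0 \<sigma>. \<forall>t. map \<omega> [0..<Suc t] \<in> set_pmf (run_prefix M s0 \<sigma> t)"
    by (intro AE_all_countable[THEN iffD2] allI AE_run_prefix)
  with AE_run_step[where M=M and \<sigma>=\<sigma>] show ?thesis
  proof eventually_elim
    case (elim \<omega>)
    have "(\<omega> t, \<omega> (Suc t)) \<in> edges M" for t
      using set_next_dist_succs[OF assms(2), of "map \<omega> [0..<Suc t]" s0]
        partial_run_run_prefix[OF assms(2,3) elim(2)[rule_format, of t]] elim(1)
      by (auto simp: succs_def)
    then show ?case using elim(1) by blast
  qed
qed


section \<open>The parameters of the rounds\<close>

text \<open>Reading the round number as a pair (N, k), the first 2 ^ (N * (N + 1)) of the rounds with first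
  component N are played with N + 1 amounts and rate 1 / 2 ^ (N + 1), and the others are void.
  The order in which the rounds are played is irrelevant.\<close>

definition level :: "nat \<Rightarrow> nat" where
  "level n = (case prod_decode n of (N, k) \<Rightarrow> if k < 2 ^ (N * (N + 1)) then N else 0)"

definition rate :: "nat \<Rightarrow> real" where
  "rate n = (case prod_decode n of (N, k) \<Rightarrow> if k < 2 ^ (N * (N + 1)) then (1 / 2) ^ (N + 1) else 0)"

lemma rate_bounds: "0 \<le> rate n" "rate n \<le> 1 / 2" "rate n \<le> 1"
proof -
  have "(1 / 2 :: real) ^ (N + 1) \<le> 1 / 2" for N
    using power_decreasing[of 1 "N + 1" "1 / 2 :: real"] by simp
  then show "0 \<le> rate n" "rate n \<le> 1 / 2" by (auto simp: rate_def split: prod.splits)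
  then show "rate n \<le> 1" by simp
qed

lemma rate_power_bounds: "0 \<le> rate n ^ k" "rate n ^ k \<le> 1"
  using rate_bounds[of n] by (auto intro: power_le_one)

text \<open>The \<open>2 ^ (N * (N + 1))\<close> non-void rounds with first component
  \<open>N\<close> cost \<open>(N + 1) * (1 / 2) ^ ((N + 1) * (N + 1))\<close> each, together
  \<open>d N\<close>. Void rounds cost 0, as their rate 0 is raised to the power 1.\<close>

lemma summable_matched_cost: "summable (\<lambda>n. real (level n + 1) * rate n ^ (level n + 1))"
proof (rule summableI_nonneg_bounded)
  define c where "c n = real (level n + 1) * rate n ^ (level n + 1)" for n
  define d where "d N = real (N + 1) * (1 / 2 :: real) ^ (N + 1)" for N
  show "0 \<le> real (level n + 1) * rate n ^ (level n + 1)" for n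
    by (simp add: rate_bounds)
  then have c_nonneg: "0 \<le> c n" for n by (simp add: c_def)
  have d: "summable d"
  proof (rule summable_ratio_test)
    \<comment> \<open>The quotient is \<open>(N + 2) / (2 * (N + 1))\<close>, which is at most 3 / 4
      from \<open>N = 1\<close> on.\<close>
    show "norm (d (Suc N)) \<le> 3 / 4 * norm (d N)" if "1 \<le> N" for N
      using that by (simp add: d_def field_simps)
  qed simp
  have d_nonneg: "0 \<le> d N" for N by (simp add: d_def)
  have row: "(\<Sum>k<T. c (prod_encode (N, k))) \<le> d N" for N T
  proof -
    have c_eq: "c (prod_encode (N, k)) =
        (if k < 2 ^ (N * (N + 1)) then real (N + 1) * ((1 / 2) ^ (N + 1)) ^ (N + 1) else 0)" for k
      by (simp add: c_def level_def rate_def)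
    have "(\<Sum>k<T. c (prod_encode (N, k))) \<le> (\<Sum>k<2 ^ (N * (N + 1)). c (prod_encode (N, k)))"
      unfolding c_eq by (subst (1 2) sum.If_cases) (auto intro!: mult_right_mono card_mono)
    also have "\<dots> = 2 ^ (N * (N + 1)) * (real (N + 1) * ((1 / 2) ^ (N + 1)) ^ (N + 1))"
      unfolding c_eq by simp
    also have "\<dots> = d N"
    proof -
      have "((1 / 2 :: real) ^ (N + 1)) ^ (N + 1) = (1 / 2) ^ (N * (N + 1)) * (1 / 2) ^ (N + 1)"
        by (simp only: power_mult[symmetric] power_add[symmetric]) (simp add: algebra_simps)
      then show ?thesis by (simp add: d_def power_divide)
    qed
    finally show ?thesis .
  qed
  show "(\<Sum>n<T. real (level n + 1) * rate n ^ (level n + 1)) \<le> suminf d" for T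
  proof -
    have "(\<Sum>n<T. c n) = (\<Sum>p\<in>prod_decode ` {..<T}. c (prod_encode p))"
      by (subst sum.reindex) (auto simp: inj_prod_decode)
    also have "\<dots> \<le> (\<Sum>p\<in>{..<T} \<times> {..<T}. c (prod_encode p))"
    proof (rule sum_mono2)
      \<comment> \<open>The pairing function dominates both components, so the rounds below
        \<open>T\<close> lie in a square of side \<open>T\<close>.\<close>
      show "prod_decode ` {..<T} \<subseteq> {..<T} \<times> {..<T}"
      proof clarify
        fix n N k assume "n < T" "(N, k) = prod_decode n"
        then show "N \<in> {..<T} \<and> k \<in> {..<T}"
          using le_prod_encode_1[of N k] le_prod_encode_2[of k N] by simp
      qed
    qed (auto simp: c_nonneg)
    also have "\<dots> = (\<Sum>N<T. \<Sum>k<T. c (prod_encode (N, k)))"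
      by (simp add: sum.cartesian_product)
    also have "\<dots> \<le> (\<Sum>N<T. d N)" by (intro sum_mono row)
    also have "\<dots> \<le> suminf d" by (intro sum_le_suminf d) (auto simp: d_nonneg)
    finally show ?thesis by (simp add: c_def)
  qed
qed

text \<open>A lower bound on the probability that round \<open>n\<close> goes wrong with at most
  \<open>K\<close> modes. It is positive only where amounts outnumber modes; the 4 combines a factor
  2 from \<open>token_lower\<close> with one from the pigeonhole argument.\<close>

definition forced_cost :: "nat \<Rightarrow> nat \<Rightarrow> real" where
  "forced_cost K n = (if K \<le> level n then rate n ^ level n / 4 else 0)"

lemma forced_cost_bounds: "0 \<le> forced_cost K n" "forced_cost K n \<le> 1"
  using rate_power_bounds[of n "level n"] by (auto simp: forced_cost_def)

text \<open>For each \<open>N \<ge> K\<close>, the \<open>2 ^ (N * (N + 1))\<close> non-void rounds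
  cost \<open>(1 / 2) ^ (N * (N + 1)) / 4\<close> each, together 1 / 4. Enough such blocks exceed
  any bound.\<close>

lemma not_summable_forced_cost: "\<not> summable (forced_cost K)"
proof
  assume summable: "summable (forced_cost K)"
  have row: "(\<Sum>k<2 ^ (N * (N + 1)). forced_cost K (prod_encode (N, k))) = 1 / 4" if "K \<le> N" for N
  proof -
    have "(\<Sum>k<2 ^ (N * (N + 1)). forced_cost K (prod_encode (N, k))) =
        (\<Sum>k<2 ^ (N * (N + 1)) :: nat. ((1 / 2 :: real) ^ (N + 1)) ^ N / 4)"
      using that by (intro sum.cong) (auto simp: forced_cost_def level_def rate_def)
    also have "\<dots> = 2 ^ (N * (N + 1)) * (1 / 2) ^ (N * (N + 1)) / 4"
      by (simp only: sum_constant card_lessThan power_mult[symmetric] mult.commute) simp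
    also have "\<dots> = 1 / 4" by (simp add: power_divide)
    finally show ?thesis .
  qed
  have bound: "real T / 4 \<le> suminf (forced_cost K)" for T
  proof -
    let ?S = "Sigma {K..<K + T} (\<lambda>N. {..<2 ^ (N * (N + 1))})"
    have "real T / 4 = (\<Sum>N\<in>{K..<K + T}. 1 / 4)" by simp
    also have "\<dots> = (\<Sum>N\<in>{K..<K + T}. \<Sum>k<2 ^ (N * (N + 1)). forced_cost K (prod_encode (N, k)))"
      by (intro sum.cong refl row[symmetric]) auto
    also have "\<dots> = (\<Sum>p\<in>?S. forced_cost K (prod_encode p))"
      by (subst sum.Sigma) (auto intro: sum.cong)
    also have "\<dots> = (\<Sum>n\<in>prod_encode ` ?S. forced_cost K n)"
      by (subst sum.reindex) (auto simp: inj_prod_encode)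
    also have "\<dots> \<le> suminf (forced_cost K)"
      by (intro sum_le_suminf summable) (auto simp: forced_cost_bounds)
    finally show ?thesis .
  qed
  obtain T :: nat where "4 * suminf (forced_cost K) < real T"
    using reals_Archimedean2 by blast
  with bound[of T] show False by simp
qed

text \<open>By \<open>1 - x \<le> exp (- x)\<close> the product is at most the exponential of minus
  a partial sum. The start \<open>m\<close> is arbitrary because winning only forces the rounds from
  some point on to be good.\<close>

lemma prod_one_minus_tendsto_0:
  fixes b :: "nat \<Rightarrow> real"
  assumes b: "\<And>n. 0 \<le> b n" "\<And>n. b n \<le> 1" and "\<not> summable b"
  shows "(\<lambda>n. \<Prod>k=m..<n. 1 - b k) \<longlonglongrightarrow> 0"
proof (rule LIMSEQ_I)
  fix e :: real assume "0 < e"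
  have "\<not> summable (\<lambda>k. b (k + m))" using assms by (simp add: summable_iff_shift)
  then have "\<not> (\<forall>n. (\<Sum>k<n. b (k + m)) \<le> - ln e)"
    using b summableI_nonneg_bounded[of "\<lambda>k. b (k + m)"] by blast
  \<comment> \<open>A partial sum above \<open>- ln e\<close> brings the exponential below
    \<open>e\<close>.\<close>
  then obtain l where l: "- ln e < (\<Sum>k<l. b (k + m))" by (meson not_le)
  have "norm ((\<Prod>k=m..<n. 1 - b k) - 0) < e" if "l + m \<le> n" for n
  proof -
    have nonneg: "0 \<le> (\<Prod>k=m..<n. 1 - b k)" by (intro prod_nonneg) (simp add: b)
    have "(\<Prod>k=m..<n. 1 - b k) \<le> (\<Prod>k=m..<n. exp (- b k))"
      using exp_ge_add_one_self[of "- b _"] by (intro prod_mono) (auto simp: b)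
    also have "\<dots> = exp (- (\<Sum>k=m..<n. b k))" by (simp add: exp_sum flip: sum_negf)
    also have "(\<Sum>k<l. b (k + m)) \<le> (\<Sum>k=m..<n. b k)"
    proof -
      have "(\<Sum>k<l. b (k + m)) = (\<Sum>k=m..<l + m. b k)"
        using sum.shift_bounds_nat_ivl[of b 0 m l] by (simp add: lessThan_atLeast0)
      also have "\<dots> \<le> (\<Sum>k=m..<n. b k)" using that by (intro sum_mono2) (auto simp: b)
      finally show ?thesis .
    qed
    then have "exp (- (\<Sum>k=m..<n. b k)) < exp (ln e)"
      using l by (subst exp_less_cancel_iff) linarith
    finally show ?thesis using nonneg \<open>0 < e\<close> by simp
  qed
  then show "\<exists>no. \<forall>n\<ge>no. norm ((\<Prod>k=m..<n. 1 - b k) - 0) < e" by blast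
qed

section \<open>The truncated geometric law of the random amount\<close>

primrec token :: "real \<Rightarrow> nat \<Rightarrow> nat pmf" where
  "token r 0 = return_pmf 0"
| "token r (Suc N) = bind_pmf (bernoulli_pmf r) (\<lambda>b. if b then token r N else return_pmf (Suc N))"

lemma set_token: "set_pmf (token r N) \<subseteq> {..N}"
  by (induction N) (auto split: if_splits simp: le_Suc_eq)

lemma prob_bind_bernoulli:
  assumes "0 \<le> r" "r \<le> 1"
  shows "measure_pmf.prob (bind_pmf (bernoulli_pmf r) f) E =
    r * measure_pmf.prob (f True) E + (1 - r) * measure_pmf.prob (f False) E"
proof -
  have "ennreal (measure_pmf.prob (bind_pmf (bernoulli_pmf r) f) E) =
      ennreal (r * measure_pmf.prob (f True) E + (1 - r) * measure_pmf.prob (f False) E)"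
  proof -
    have "ennreal (measure_pmf.prob (bind_pmf (bernoulli_pmf r) f) E) =
        (\<integral>\<^sup>+b. emeasure (measure_pmf (f b)) E \<partial>bernoulli_pmf r)"
      by (simp only: measure_pmf.emeasure_eq_measure[symmetric] emeasure_bind_pmf)
    also have "\<dots> = ennreal (measure_pmf.prob (f True) E) * ennreal r +
        ennreal (measure_pmf.prob (f False) E) * ennreal (1 - r)"
      using assms by (subst nn_integral_bernoulli_pmf)
        (simp_all add: measure_pmf.emeasure_eq_measure)
    also have "\<dots> = ennreal (r * measure_pmf.prob (f True) E + (1 - r) * measure_pmf.prob (f False) E)"
      using assms by (simp add: mult.commute ennreal_mult ennreal_plus)
    finally show ?thesis .
  qed
  moreover have "0 \<le> r * measure_pmf.prob (f True) E + (1 - r) * measure_pmf.prob (f False) E"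
    using assms by (intro add_nonneg_nonneg mult_nonneg_nonneg) auto
  ultimately show ?thesis
    by (simp only: ennreal_inj[OF measure_nonneg])
qed

text \<open>An amount \<open>i > 0\<close> has probability \<open>(1 - r) * r ^ (N - i)\<close>,
  where \<open>1 - r\<close> is at least 1 / 2, and the amount 0 has probability
  \<open>r ^ N\<close>.\<close>

lemma token_lower:
  assumes r: "0 \<le> r" "r \<le> 1 / 2" and "i \<le> N"
  shows "r ^ (N - i) / 2 \<le> pmf (token r N) i"
  using \<open>i \<le> N\<close>
proof (induction N)
  case (Suc N)
  have *: "pmf (token r (Suc N)) i = r * pmf (token r N) i + (1 - r) * pmf (return_pmf (Suc N)) i"
    unfolding measure_pmf_single[symmetric] token.simps
    by (subst prob_bind_bernoulli) (use r in auto)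
  show ?case
  proof (cases "i = Suc N")
    case True
    then show ?thesis unfolding * using r by (simp add: indicator_def add_increasing)
  next
    case False
    then show ?thesis unfolding * using r Suc mult_left_mono[OF Suc.IH, of r]
      by (simp add: Suc_diff_le indicator_def)
  qed
qed simp

text \<open>The amount \<open>i\<close> is drawn with probability at most \<open>r ^ (N - i)\<close>
  and then costs at most \<open>r ^ (i + 1)\<close>. So each of the \<open>N + 1\<close> amounts
  contributes at most \<open>r ^ (N + 1)\<close>.\<close>

lemma token_cost_upper:
  assumes r: "0 \<le> r" "r \<le> 1"
    and f: "\<And>i. i \<le> N \<Longrightarrow> measure_pmf.prob (f i) E \<le> r ^ (i + 1)"
  shows "measure_pmf.prob (bind_pmf (token r N) f) E \<le> real (N + 1) * r ^ (N + 1)"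
  using f
proof (induction N)
  case 0
  then show ?case by (simp add: bind_return_pmf)
next
  case (Suc N)
  have "bind_pmf (token r (Suc N)) f =
      bind_pmf (bernoulli_pmf r) (\<lambda>b. if b then bind_pmf (token r N) f else f (Suc N))"
    by (auto simp: bind_assoc_pmf bind_return_pmf intro!: bind_pmf_cong)
  then have "measure_pmf.prob (bind_pmf (token r (Suc N)) f) E =
      r * measure_pmf.prob (bind_pmf (token r N) f) E + (1 - r) * measure_pmf.prob (f (Suc N)) E"
    by (simp only: prob_bind_bernoulli[OF r] if_True if_False)
  also have "\<dots> \<le> r * (real (N + 1) * r ^ (N + 1)) + 1 * r ^ (Suc N + 1)"
  proof (intro add_mono mult_mono)
    show "measure_pmf.prob (bind_pmf (token r N) f) E \<le> real (N + 1) * r ^ (N + 1)"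
      by (rule Suc.IH) (rule Suc.prems, simp)
    show "measure_pmf.prob (f (Suc N)) E \<le> r ^ (Suc N + 1)"
      by (rule Suc.prems) simp
  qed (use r in auto)
  also have "\<dots> = real (Suc N + 1) * r ^ (Suc N + 1)" by (simp add: algebra_simps)
  finally show ?case .
qed


section \<open>The game\<close>

text \<open>Coding states as naturals makes the state type countable, as \<open>run_measure\<close>
  requires, and storing the step in the code makes the step counter implicit.\<close>

abbreviation node :: "nat \<Rightarrow> nat \<Rightarrow> nat" where
  "node t x \<equiv> prod_encode (t, x)"

definition depth :: "nat \<Rightarrow> nat" where
  "depth s = fst (prod_decode s)"

definition label :: "nat \<Rightarrow> nat" where
  "label s = snd (prod_decode s)"

lemma depth_node [simp]: "depth (node t x) = t" and label_node [simp]: "label (node t x) = x"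
  by (simp_all add: depth_def label_def)

lemma node_depth_label [simp]: "node (depth s) (label s) = s"
  by (simp add: depth_def label_def)

text \<open>The largest label in layer \<open>t\<close>: a loss flag between rounds, no information
  where the player pays, an amount in the other two layers.\<close>

definition width :: "nat \<Rightarrow> nat" where
  "width t = (if t mod 4 = 0 then 1 else if t mod 4 = 2 then 0 else level (t div 4))"

text \<open>Place values of the mixed radix system whose digit in position \<open>k\<close> ranges
  over 0, ..., \<open>level k\<close>.\<close>

primrec scale :: "nat \<Rightarrow> nat" where
  "scale 0 = 1"
| "scale (Suc n) = (level n + 1) * scale n"

text \<open>Round n takes the steps 4 * n to 4 * n + 3. First a random amount i is received, in units of
  scale n. The next layer has a single state, so i is then visible only in the accumulated reward.
  There the player pays an amount j. Finally scale (Suc n) is lost with probability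
  rate n ^ (j + 1), and refunded in the next step, where the label 1 records the loss.
  As scale n exceeds everything that can be saved up in the earlier rounds, each round in which
  j exceeds i or the loss occurs makes the accumulated reward negative.\<close>

definition game :: "nat mdp" where
  "game =
    \<lparr>ctrl = {s. depth s mod 4 = 2 \<and> label s \<le> width (depth s)},
     rand = {s. depth s mod 4 \<noteq> 2 \<and> label s \<le> width (depth s)},
     edges = {(s, s'). depth s' = Suc (depth s) \<and>
       label s \<le> width (depth s) \<and> label s' \<le> width (depth s')},
     tprob = (\<lambda>s. let t = depth s; n = t div 4 in
       if t mod 4 = 0 then map_pmf (node (Suc t)) (token (rate n) (level n))
       else if t mod 4 = 3 then map_pmf (\<lambda>b. node (Suc t) (of_bool b)) (bernoulli_pmf (rate n ^ (label s + 1)))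
       else return_pmf (node (Suc t) 0)),
     reward = (\<lambda>(s, s'). let t = depth s; n = t div 4 in
       if t mod 4 = 0 then real ((label s + label s') * scale n)
       else if t mod 4 = 2 then - real (label s' * scale n)
       else if t mod 4 = 3 then - real (label s' * scale (Suc n))
       else 0)\<rparr>"

lemma states_game: "s \<in> states game \<longleftrightarrow> label s \<le> width (depth s)"
  by (auto simp: states_def game_def)

lemma ctrl_game: "s \<in> ctrl game \<longleftrightarrow> depth s mod 4 = 2 \<and> label s \<le> width (depth s)"
  by (simp add: game_def)

lemma rand_game: "s \<in> rand game \<longleftrightarrow> depth s mod 4 \<noteq> 2 \<and> label s \<le> width (depth s)"
  by (simp add: game_def)

lemma edges_game: "(s, s') \<in> edges game \<longleftrightarrow>
    depth s' = Suc (depth s) \<and> label s \<le> width (depth s) \<and> label s' \<le> width (depth s')"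
  by (simp add: game_def)

lemma edges_game_states: "(s, s') \<in> edges game \<Longrightarrow> s \<in> states game \<and> s' \<in> states game"
  by (auto simp: edges_game states_game)

lemma width_simps [simp]:
  "width (4 * n) = 1" "width (4 * n + 1) = level n" "width (4 * n + 2) = 0"
  "width (4 * n + 3) = level n" "width (4 * n + 4) = 1"
proof -
  have "(4 * n + 1) mod 4 = 1" "(4 * n + 2) mod 4 = 2" "(4 * n + 3) mod 4 = 3" "(4 * n + 4) mod 4 = 0"
    "(4 * n + 1) div 4 = n" "(4 * n + 2) div 4 = n" "(4 * n + 3) div 4 = n"
    by presburger+
  then show "width (4 * n) = 1" "width (4 * n + 1) = level n" "width (4 * n + 2) = 0"
    "width (4 * n + 3) = level n" "width (4 * n + 4) = 1"
    by (simp_all only: width_def) simp_all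
qed

lemma width_Suc [simp]: "width (Suc (4 * n)) = level n"
  using width_simps(2)[of n] by simp

lemma tprob_game:
  "depth s = 4 * n \<Longrightarrow> tprob game s = map_pmf (node (4 * n + 1)) (token (rate n) (level n))"
  "depth s = 4 * n + 1 \<Longrightarrow> tprob game s = return_pmf (node (4 * n + 2) 0)"
  "depth s = 4 * n + 3 \<Longrightarrow> tprob game s =
     map_pmf (\<lambda>b. node (4 * n + 4) (of_bool b)) (bernoulli_pmf (rate n ^ (label s + 1)))"
proof -
  have "(4 * n + 1) mod 4 = 1" "(4 * n + 3) mod 4 = 3" "(4 * n + 3) div 4 = n"
    by presburger+
  then show
    "depth s = 4 * n \<Longrightarrow> tprob game s = map_pmf (node (4 * n + 1)) (token (rate n) (level n))"
    "depth s = 4 * n + 1 \<Longrightarrow> tprob game s = return_pmf (node (4 * n + 2) 0)"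
    "depth s = 4 * n + 3 \<Longrightarrow> tprob game s =
       map_pmf (\<lambda>b. node (4 * n + 4) (of_bool b)) (bernoulli_pmf (rate n ^ (label s + 1)))"
    by (simp_all add: game_def Let_def add.commute)
qed

lemma reward_game:
  "depth s = 4 * n \<Longrightarrow> reward game (s, s') = real ((label s + label s') * scale n)"
  "depth s = 4 * n + 1 \<Longrightarrow> reward game (s, s') = 0"
  "depth s = 4 * n + 2 \<Longrightarrow> reward game (s, s') = - real (label s' * scale n)"
  "depth s = 4 * n + 3 \<Longrightarrow> reward game (s, s') = - real (label s' * scale (Suc n))"
proof -
  have "(4 * n + 1) mod 4 = 1" "(4 * n + 2) mod 4 = 2" "(4 * n + 3) mod 4 = 3"
    "(4 * n + 2) div 4 = n" "(4 * n + 3) div 4 = n"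
    by presburger+
  then show "depth s = 4 * n \<Longrightarrow> reward game (s, s') = real ((label s + label s') * scale n)"
    "depth s = 4 * n + 1 \<Longrightarrow> reward game (s, s') = 0"
    "depth s = 4 * n + 2 \<Longrightarrow> reward game (s, s') = - real (label s' * scale n)"
    "depth s = 4 * n + 3 \<Longrightarrow> reward game (s, s') = - real (label s' * scale (Suc n))"
    by (simp_all add: game_def Let_def del: scale.simps)
qed

lemma phase_cases:
  fixes t :: nat
  obtains n where "t = 4 * n" | n where "t = 4 * n + 1" | n where "t = 4 * n + 2" | n where "t = 4 * n + 3"
proof -
  have "t = 4 * (t div 4) \<or> t = 4 * (t div 4) + 1 \<or> t = 4 * (t div 4) + 2 \<or> t = 4 * (t div 4) + 3"
    by presburger
  then show thesis using that by blast
qed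

section \<open>Structural properties of the game\<close>

lemma succs_game: "s \<in> states game \<Longrightarrow> succs game s = node (Suc (depth s)) ` {..width (Suc (depth s))}"
proof (intro set_eqI iffI)
  fix s' assume "s \<in> states game" "s' \<in> succs game s"
  then have "s' = node (Suc (depth s)) (label s')" "label s' \<le> width (Suc (depth s))"
    using node_depth_label[of s'] by (auto simp: succs_def edges_game simp del: node_depth_label)
  then show "s' \<in> node (Suc (depth s)) ` {..width (Suc (depth s))}" by blast
qed (auto simp: succs_def edges_game states_game)

lemma MDP_game: "MDP game"
proof
  show "countable (states game)" by simp
  show "ctrl game \<inter> rand game = {}" by (auto simp: ctrl_game rand_game)
  show "edges game \<subseteq> states game \<times> states game" using edges_game_states by auto
  show "succs game s \<noteq> {}" if "s \<in> states game" for s by (simp add: succs_game that)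
  show "set_pmf (tprob game s) \<subseteq> succs game s" if s: "s \<in> rand game" for s
  proof -
    have st: "s \<in> states game" using s by (simp add: states_def)
    show ?thesis
    proof (cases "depth s" rule: phase_cases)
      case (1 n)
      then show ?thesis
        using set_token[of "rate n" "level n"] by (auto simp: succs_game[OF st] tprob_game)
    next
      case (2 n)
      then show ?thesis by (auto simp: succs_game[OF st] tprob_game)
    next
      case (3 n)
      then have "depth s mod 4 = 2" by presburger
      then show ?thesis using s by (simp add: rand_game)
    next
      case (4 n)
      then have "width (Suc (depth s)) = 1" using width_simps(5)[of n] by (simp add: numeral_eq_Suc)
      then show ?thesis using 4 by (auto simp: succs_game[OF st] tprob_game)
    qed
  qed
qed

lemma finitely_branching_game: "finitely_branching game"
  by (simp add: finitely_branching_def succs_game)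

text \<open>Every edge leads to the next layer, which yields both acyclicity and the implicit step
  counter.\<close>

lemma depth_relpow: "(s, s') \<in> edges game ^^ n \<Longrightarrow> depth s' = depth s + n"
  by (induction n arbitrary: s') (auto simp: edges_game)

lemma acyclic_game: "acyclic_mdp game"
  unfolding acyclic_mdp_def
proof (intro acyclicI allI notI)
  fix s assume "(s, s) \<in> (edges game)\<^sup>+"
  then obtain n where "0 < n" "(s, s) \<in> edges game ^^ n"
    by (auto simp: trancl_power)
  then show False using depth_relpow by fastforce
qed

lemma step_counter_implicit_game: "step_counter_implicit game s"
  using depth_relpow[of s] unfolding step_counter_implicit_def by (metis add_left_cancel)

lemma integer_rewards_game: "integer_rewards game"
  by (auto simp: integer_rewards_def game_def Let_def)


section \<open>Accumulated rewards\<close>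

definition start :: nat where "start = node 0 0"

definition is_path :: "(nat \<Rightarrow> nat) \<Rightarrow> bool" where
  "is_path \<omega> \<longleftrightarrow> \<omega> 0 = start \<and> (\<forall>t. (\<omega> t, \<omega> (Suc t)) \<in> edges game)"

definition payoff :: "(nat \<Rightarrow> nat) \<Rightarrow> nat \<Rightarrow> real" where
  "payoff \<omega> n = (\<Sum>t<n. reward game (\<omega> t, \<omega> (Suc t)))"

text \<open>The savings of the first \<open>n\<close> rounds, received minus paid. Losses do not
  enter, because each is refunded.\<close>

definition balance :: "(nat \<Rightarrow> nat) \<Rightarrow> nat \<Rightarrow> real" where
  "balance \<omega> n = (\<Sum>k<n. (real (label (\<omega> (4 * k + 1))) - real (label (\<omega> (4 * k + 3)))) * scale k)"

definition good_round :: "nat \<Rightarrow> (nat \<Rightarrow> nat) \<Rightarrow> bool" where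
  "good_round n \<omega> \<longleftrightarrow>
     label (\<omega> (4 * n + 3)) \<le> label (\<omega> (4 * n + 1)) \<and> label (\<omega> (4 * n + 4)) = 0"

lemma path_step: "is_path \<omega> \<Longrightarrow> (\<omega> t, \<omega> (Suc t)) \<in> edges game"
  by (simp add: is_path_def)

lemma depth_path:
  assumes "is_path \<omega>"
  shows "depth (\<omega> t) = t"
proof (induction t)
  case 0
  then show ?case using assms by (simp add: is_path_def start_def)
next
  case (Suc t)
  then show ?case using path_step[OF assms, of t] by (simp add: edges_game)
qed

lemma label_path: "is_path \<omega> \<Longrightarrow> label (\<omega> t) \<le> width t"
  using path_step[of \<omega> t] depth_path[of \<omega> t] by (simp add: edges_game)

text \<open>A loss is refunded in the first step of the next round, so at step \<open>4 * n\<close>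
  the payoff differs from the balance only by the loss still outstanding.\<close>

lemma payoff_path:
  assumes "is_path \<omega>"
  shows "payoff \<omega> (4 * n) = balance \<omega> n - real (label (\<omega> (4 * n)) * scale n)"
    and "payoff \<omega> (4 * n + 1) = balance \<omega> n + real (label (\<omega> (4 * n + 1)) * scale n)"
    and "payoff \<omega> (4 * n + 2) = balance \<omega> n + real (label (\<omega> (4 * n + 1)) * scale n)"
    and "payoff \<omega> (4 * n + 3) = balance \<omega> (Suc n)"
    and "payoff \<omega> (4 * n + 4) = balance \<omega> (Suc n) - real (label (\<omega> (4 * n + 4)) * scale (Suc n))"
proof -
  have step: "payoff \<omega> (Suc t) = payoff \<omega> t + reward game (\<omega> t, \<omega> (Suc t))" for t
    by (simp add: payoff_def)
  have round: "payoff \<omega> (4 * n + 1) = balance \<omega> n + real (label (\<omega> (4 * n + 1)) * scale n) \<and>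
      payoff \<omega> (4 * n + 2) = balance \<omega> n + real (label (\<omega> (4 * n + 1)) * scale n) \<and>
      payoff \<omega> (4 * n + 3) = balance \<omega> (Suc n) \<and>
      payoff \<omega> (4 * n + 4) = balance \<omega> (Suc n) - real (label (\<omega> (4 * n + 4)) * scale (Suc n))"
    if start: "payoff \<omega> (4 * n) = balance \<omega> n - real (label (\<omega> (4 * n)) * scale n)" for n
  proof -
    note d = depth_path[OF assms]
    have 1: "payoff \<omega> (4 * n + 1) = balance \<omega> n + real (label (\<omega> (4 * n + 1)) * scale n)"
      using step[of "4 * n"] start reward_game(1)[OF d] by (simp add: algebra_simps)
    have 2: "payoff \<omega> (4 * n + 2) = payoff \<omega> (4 * n + 1)"
      using step[of "4 * n + 1"] reward_game(2)[OF d] by simp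
    have 3: "payoff \<omega> (4 * n + 3) = payoff \<omega> (4 * n + 2) - real (label (\<omega> (4 * n + 3)) * scale n)"
      using step[of "4 * n + 2"] reward_game(3)[OF d] by (simp add: numeral_eq_Suc)
    have 4: "payoff \<omega> (4 * n + 4) =
        payoff \<omega> (4 * n + 3) - real (label (\<omega> (4 * n + 4)) * scale (Suc n))"
      using step[of "4 * n + 3"] reward_game(4)[OF d] by (simp add: numeral_eq_Suc del: scale.simps)
    show ?thesis
      using 1 2 3 4 by (simp add: balance_def algebra_simps del: scale.simps)
  qed
  have start: "payoff \<omega> (4 * n) = balance \<omega> n - real (label (\<omega> (4 * n)) * scale n)" for n
  proof (induction n)
    case 0
    then show ?case using assms by (simp add: payoff_def balance_def is_path_def start_def)
  next
    case (Suc n)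
    then show ?case using round[OF Suc.IH] by (simp add: add.commute del: scale.simps)
  qed
  show "payoff \<omega> (4 * n) = balance \<omega> n - real (label (\<omega> (4 * n)) * scale n)"
    "payoff \<omega> (4 * n + 1) = balance \<omega> n + real (label (\<omega> (4 * n + 1)) * scale n)"
    "payoff \<omega> (4 * n + 2) = balance \<omega> n + real (label (\<omega> (4 * n + 1)) * scale n)"
    "payoff \<omega> (4 * n + 3) = balance \<omega> (Suc n)"
    "payoff \<omega> (4 * n + 4) = balance \<omega> (Suc n) - real (label (\<omega> (4 * n + 4)) * scale (Suc n))"
    using start round[OF start] by blast+
qed

text \<open>At best each round saves \<open>level k\<close> units of \<open>scale k\<close>, and
  these maximal savings telescope to \<open>scale n - 1\<close>.\<close>

lemma balance_less_scale:
  assumes "is_path \<omega>"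
  shows "balance \<omega> n \<le> real (scale n) - 1"
proof (induction n)
  case (Suc n)
  have "label (\<omega> (4 * n + 1)) \<le> level n" using label_path[OF assms, of "4 * n + 1"] by simp
  then have "(real (label (\<omega> (4 * n + 1))) - real (label (\<omega> (4 * n + 3)))) * scale n \<le>
      real (level n) * scale n"
    by (intro mult_right_mono) auto
  then show ?case using Suc.IH by (simp add: balance_def algebra_simps)
qed (simp add: balance_def)

text \<open>A loss of \<open>scale (Suc n)\<close> exceeds all savings up to then, and overpaying by
  one unit of \<open>scale n\<close> exceeds all earlier savings. The value is at most - 1 and not
  merely negative, so infinitely many bad rounds keep the limes inferior below 0.\<close>

lemma bad_round_payoff:
  assumes "is_path \<omega>" "\<not> good_round n \<omega>"
  shows "\<exists>t\<ge>n. payoff \<omega> t \<le> - 1"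
proof (cases "label (\<omega> (4 * n + 3)) \<le> label (\<omega> (4 * n + 1))")
  case True
  then have "1 \<le> label (\<omega> (4 * n + 4))" using assms(2) by (auto simp: good_round_def)
  then have "scale (Suc n) \<le> label (\<omega> (4 * n + 4)) * scale (Suc n)" by (simp del: scale.simps)
  then have "payoff \<omega> (4 * n + 4) \<le> - 1"
    unfolding payoff_path(5)[OF assms(1)] using balance_less_scale[OF assms(1), of "Suc n"]
    by linarith
  then show ?thesis by (intro exI[of _ "4 * n + 4"]) simp
next
  case False
  then have "(real (label (\<omega> (4 * n + 1))) - real (label (\<omega> (4 * n + 3)))) * scale n \<le> (- 1) * real (scale n)"
    by (intro mult_right_mono) auto
  then have "balance \<omega> (Suc n) \<le> - 1"
    using balance_less_scale[OF assms(1), of n] by (simp add: balance_def)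
  then show ?thesis using payoff_path(4)[OF assms(1), of n] by (intro exI[of _ "4 * n + 3"]) simp
qed

lemma eventually_good_round:
  assumes "is_path \<omega>" "\<omega> \<in> TP_liminf_ge_0 game"
  shows "\<exists>m. \<forall>n\<ge>m. good_round n \<omega>"
proof -
  have "ereal (- 1) < liminf (\<lambda>n. ereal (payoff \<omega> n))"
    using assms(2) less_le_trans[of "ereal (- 1)" 0] by (auto simp: TP_liminf_ge_0_def payoff_def)
  then have "eventually (\<lambda>n. ereal (- 1) < ereal (payoff \<omega> n)) sequentially"
    by (rule less_LiminfD)
  then obtain m where m: "\<And>n. m \<le> n \<Longrightarrow> - 1 < payoff \<omega> n"
    by (auto simp: eventually_sequentially)
  have "good_round n \<omega>" if "m \<le> n" for n
    using bad_round_payoff[OF assms(1), of n] m that by (meson le_trans not_le)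
  then show ?thesis by blast
qed

text \<open>The balance stays 0, so only an outstanding loss can make the payoff negative, and
  losses cease.\<close>

lemma matched_in_TP:
  assumes path: "is_path \<omega>" and matched: "\<And>n. label (\<omega> (4 * n + 3)) = label (\<omega> (4 * n + 1))"
    and ev: "eventually (\<lambda>n. label (\<omega> (4 * n + 4)) = 0) sequentially"
  shows "\<omega> \<in> TP_liminf_ge_0 game"
proof -
  have balance: "balance \<omega> n = 0" for n by (simp add: balance_def matched)
  obtain m where m: "\<And>n. m \<le> n \<Longrightarrow> label (\<omega> (4 * n + 4)) = 0"
    using ev by (auto simp: eventually_sequentially)
  \<comment> \<open>Round \<open>m\<close> ends at step \<open>4 * m + 4\<close>; from there on a
    round boundary \<open>4 * Suc k\<close> has \<open>m \<le> k\<close>, hence no loss.\<close>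
  have "0 \<le> payoff \<omega> t" if t: "4 * m + 4 \<le> t" for t
  proof (cases t rule: phase_cases)
    case (1 n)
    then obtain k where "n = Suc k" "m \<le> k" using t by (cases n) auto
    then show ?thesis using 1 m payoff_path(5)[OF path, of k] by (simp add: balance add.commute)
  qed (use payoff_path[OF path] in \<open>auto simp: balance\<close>)
  then have "0 \<le> liminf (\<lambda>n. ereal (payoff \<omega> n))"
    by (intro Liminf_bounded) (auto simp: eventually_sequentially)
  then show ?thesis by (simp add: TP_liminf_ge_0_def payoff_def)
qed


section \<open>Bounded memory loses\<close>

text \<open>Pigeonhole: otherwise each of the \<open>N + 1\<close> amounts has probability above 1 /
  2 in some mode. Two disjoint events cannot both be that likely in one mode, so there would be more
  than \<open>N\<close> modes.\<close>

lemma prob_some_label_le_half: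
  fixes P :: "'m \<Rightarrow> ('m \<times> nat) pmf"
  assumes "finite Q" "card Q \<le> N"
  shows "\<exists>i\<le>N. \<forall>m\<in>Q. measure_pmf.prob (P m) {y. label (snd y) = i} \<le> 1 / 2"
proof (rule ccontr)
  let ?L = "\<lambda>i. {y :: 'm \<times> nat. label (snd y) = i}"
  assume "\<not> ?thesis"
  then have "\<forall>i\<le>N. \<exists>m\<in>Q. 1 / 2 < measure_pmf.prob (P m) (?L i)" by (meson not_le)
  then obtain f where f: "\<And>i. i \<le> N \<Longrightarrow> f i \<in> Q \<and> 1 / 2 < measure_pmf.prob (P (f i)) (?L i)"
    by metis
  have "inj_on f {..N}"
  proof (rule inj_onI, rule ccontr)
    fix i j assume ij: "i \<in> {..N}" "j \<in> {..N}" "f i = f j" "i \<noteq> j"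
    have "measure_pmf.prob (P (f i)) (?L i \<union> ?L j) =
        measure_pmf.prob (P (f i)) (?L i) + measure_pmf.prob (P (f i)) (?L j)"
      using ij(4) by (intro measure_pmf.finite_measure_Union) auto
    moreover have "1 / 2 < measure_pmf.prob (P (f i)) (?L j)" "1 / 2 < measure_pmf.prob (P (f i)) (?L i)"
      using f[of i] f[of j] ij by auto
    ultimately have "1 < measure_pmf.prob (P (f i)) (?L i \<union> ?L j)" by linarith
    then show False using measure_pmf.prob_le_1[of "P (f i)"] by (meson not_le)
  qed
  then have "card {..N} \<le> card Q"
    using f assms(1) by (intro card_inj_on_le) auto
  then show False using assms(2) by simp
qed

lemma memory_rand:
  "memory_structure M Q \<tau> \<Longrightarrow> m \<in> Q \<Longrightarrow> s \<in> rand M \<Longrightarrow> map_pmf snd (\<tau> (m, s)) = tprob M s"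
  by (simp add: memory_structure_def)

text \<open>The sets R t are the modes that are possible at step t. Bounding only their cardinalities covers
  finite memories and memories with a step counter alike.\<close>

locale bounded_memory =
  fixes Q :: "'m set" and \<tau> :: "'m \<times> nat \<Rightarrow> ('m \<times> nat) pmf" and R :: "nat \<Rightarrow> 'm set" and K :: nat
  assumes memory: "memory_structure game Q \<tau>"
    and R_subset: "R t \<subseteq> Q"
    and finite_R: "finite (R t)"
    and card_R: "card (R t) \<le> K"
    and R_step: "m \<in> R (depth s) \<Longrightarrow> s \<in> states game \<Longrightarrow> (m', s') \<in> set_pmf (\<tau> (m, s)) \<Longrightarrow>
      m' \<in> R (Suc (depth s))"
begin

definition at_step :: "nat \<Rightarrow> ('m \<times> nat) set" where
  "at_step t = {(m, s). m \<in> R t \<and> s \<in> states game \<and> depth s = t}"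

lemma at_step_Suc:
  assumes "y \<in> at_step t" "y' \<in> set_pmf (\<tau> y)"
  shows "y' \<in> at_step (Suc t)"
proof -
  obtain m s where y: "y = (m, s)" "m \<in> R t" "s \<in> states game" "depth s = t"
    using assms(1) by (auto simp: at_step_def)
  have e: "(s, snd y') \<in> edges game"
    using MDP.memory_step(2)[OF MDP_game memory, of m s "fst y'" "snd y'"] y assms(2) R_subset by auto
  then have "snd y' \<in> states game" "depth (snd y') = Suc t"
    using edges_game_states[OF e] y by (auto simp: edges_game)
  moreover have "fst y' \<in> R (Suc t)"
    using R_step[of m s "fst y'" "snd y'"] y assms(2) by simp
  ultimately show ?thesis by (cases y') (simp add: at_step_def)
qed

lemma last_chain_prefix:
  assumes "(m0, start) \<in> at_step 0" "xs \<in> set_pmf (chain_prefix \<tau> (m0, start) t)"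
  shows "last xs \<in> at_step t"
  using assms(2)
proof (induction t arbitrary: xs)
  case 0
  then show ?case using assms(1) by simp
next
  case (Suc t)
  then obtain ys y where "ys \<in> set_pmf (chain_prefix \<tau> (m0, start) t)"
    "y \<in> set_pmf (\<tau> (last ys))" "xs = ys @ [y]"
    by auto
  then show ?case using at_step_Suc[OF Suc.IH] by simp
qed

lemma prob_label_rand:
  assumes "(m, s) \<in> at_step t" "t mod 4 \<noteq> 2"
  shows "measure_pmf.prob (\<tau> (m, s)) {y. label (snd y) = i} =
    measure_pmf.prob (tprob game s) {s'. label s' = i}"
proof -
  have "map_pmf snd (\<tau> (m, s)) = tprob game s"
    using assms R_subset by (intro memory_rand[OF memory]) (auto simp: at_step_def rand_game states_game)
  then have "measure_pmf.prob (tprob game s) {s'. label s' = i} =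
      measure_pmf.prob (map_pmf snd (\<tau> (m, s))) {s'. label s' = i}"
    by simp
  then show ?thesis by (simp add: vimage_def)
qed

text \<open>A whole round as one random step. The four new pairs carry the amount received, the
  forgetting state, the amount paid and the loss flag.\<close>

definition play_round :: "('m \<times> nat) list \<Rightarrow> ('m \<times> nat) list pmf" where
  "play_round xs = bind_pmf (\<tau> (last xs)) (\<lambda>y1. bind_pmf (\<tau> y1) (\<lambda>y2. bind_pmf (\<tau> y2) (\<lambda>y3.
     map_pmf (\<lambda>y4. xs @ [y1, y2, y3, y4]) (\<tau> y3))))"

lemma chain_prefix_round:
  "chain_prefix \<tau> x (4 * Suc n) = bind_pmf (chain_prefix \<tau> x (4 * n)) play_round"
  by (simp add: play_round_def[abs_def] bind_assoc_pmf bind_map_pmf map_bind_pmf eval_nat_numeral)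

definition good :: "nat \<Rightarrow> ('m \<times> nat) list \<Rightarrow> bool" where
  "good n xs \<longleftrightarrow> good_round n (\<lambda>t. map snd xs ! t)"

lemma good_append:
  assumes "4 * n + 4 < length xs"
  shows "good n (xs @ ys) = good n xs"
  using assms by (simp add: good_def good_round_def nth_append)

lemma good_extended:
  assumes "length xs = 4 * n + 1"
  shows "good n (xs @ [y1, y2, y3, y4]) \<longleftrightarrow> label (snd y3) \<le> label (snd y1) \<and> label (snd y4) = 0"
  using assms by (simp add: good_def good_round_def nth_append)

text \<open>One unfavourable branch suffices: an amount \<open>i\<close> that no possible mode pays
  with probability above 1 / 2 is received, something else is paid, and the round goes
  wrong.\<close>

lemma prob_bad_round:
  assumes len: "length xs = 4 * n + 1" and last: "last xs \<in> at_step (4 * n)" and "K \<le> level n"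
  shows "rate n ^ level n / 4 \<le> measure_pmf.prob (play_round xs) {ys. \<not> good n ys}"
proof -
  let ?r = "rate n" and ?N = "level n" and ?L = "\<lambda>i. {y :: 'm \<times> nat. label (snd y) = i}"
  let ?bad = "{ys. \<not> good n ys}"
  have r: "0 \<le> ?r" "?r \<le> 1 / 2" "?r \<le> 1" by (rule rate_bounds)+
  have mods: "(4 * n + 1) mod 4 \<noteq> 2" "(4 * n + 3) mod 4 \<noteq> 2" by presburger+
  \<comment> \<open>A single \<open>i\<close> serves all modes possible at this step. The state is
    the same after every amount, so only the mode can tell amounts apart.\<close>
  obtain i where i: "i \<le> ?N"
    "\<And>m. m \<in> R (4 * n + 2) \<Longrightarrow> measure_pmf.prob (\<tau> (m, node (4 * n + 2) 0)) (?L i) \<le> 1 / 2"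
    using prob_some_label_le_half[OF finite_R[of "4 * n + 2"],
        where P="\<lambda>m. \<tau> (m, node (4 * n + 2) 0)"]
      card_R[of "4 * n + 2"] \<open>K \<le> level n\<close> by (meson le_trans)
  \<comment> \<open>Paying more than \<open>i\<close> is bad with certainty; paying
    \<open>j < i\<close> is lost with probability \<open>?r ^ (j + 1)\<close>, which is at least
    \<open>?r ^ i\<close>.\<close>
  have pay: "?r ^ i \<le> measure_pmf.prob (map_pmf (\<lambda>y4. xs @ [y1, y2, y3, y4]) (\<tau> y3)) ?bad"
    if y1: "label (snd y1) = i" and y3: "y3 \<in> at_step (4 * n + 3)" "label (snd y3) \<noteq> i"
    for y1 y2 y3
  proof (cases "i < label (snd y3)")
    case True
    then have "(\<lambda>y4. xs @ [y1, y2, y3, y4]) -` ?bad = UNIV"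
      using y1 good_extended[OF len] by auto
    then show ?thesis using power_le_one[OF r(1,3)] by simp
  next
    case False
    let ?j = "label (snd y3)"
    have d: "depth (snd y3) = 4 * n + 3" using y3(1) by (auto simp: at_step_def)
    have "?r ^ i \<le> ?r ^ (?j + 1)"
      using False y3(2) r by (intro power_decreasing) auto
    also have "\<dots> = pmf (bernoulli_pmf (?r ^ (?j + 1))) True"
      by (intro pmf_bernoulli_True[symmetric] rate_power_bounds)
    also have "\<dots> = measure_pmf.prob (tprob game (snd y3)) {s'. label s' = 1}"
      unfolding tprob_game(3)[OF d] measure_map_pmf measure_pmf_single[symmetric]
      by (rule arg_cong[where f="measure_pmf.prob _"]) auto
    also have "\<dots> = measure_pmf.prob (\<tau> y3) (?L 1)"
      using prob_label_rand[of "fst y3" "snd y3" "4 * n + 3" 1] y3(1) mods by simp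
    also have "\<dots> \<le> measure_pmf.prob (\<tau> y3) ((\<lambda>y4. xs @ [y1, y2, y3, y4]) -` ?bad)"
      using good_extended[OF len] by (intro measure_pmf.finite_measure_mono) auto
    finally show ?thesis by simp
  qed
  have choose: "1 / 2 * ?r ^ i \<le> measure_pmf.prob (bind_pmf (\<tau> y2) (\<lambda>y3.
      map_pmf (\<lambda>y4. xs @ [y1, y2, y3, y4]) (\<tau> y3))) ?bad"
    if y1: "label (snd y1) = i" and y2: "y2 \<in> at_step (4 * n + 2)" for y1 y2
  proof -
    obtain m where m: "m \<in> R (4 * n + 2)" "y2 = (m, node (4 * n + 2) 0)"
    proof -
      have "snd y2 = node (4 * n + 2) 0"
        using y2 node_depth_label[of "snd y2"] width_simps(3)[of n]
        by (auto simp: at_step_def states_game simp del: node_depth_label)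
      then show thesis using y2 that[of "fst y2"] by (auto simp: at_step_def)
    qed
    have "1 / 2 \<le> measure_pmf.prob (\<tau> y2) (- ?L i)"
      using i(2)[OF m(1)] measure_pmf.prob_compl[of "?L i" "\<tau> y2"] m(2) by (simp add: Compl_eq_Diff_UNIV)
    then have "1 / 2 * ?r ^ i \<le> measure_pmf.prob (\<tau> y2) (- ?L i) * ?r ^ i"
      using r by (intro mult_right_mono) auto
    also have "\<dots> \<le> measure_pmf.prob (bind_pmf (\<tau> y2) (\<lambda>y3.
        map_pmf (\<lambda>y4. xs @ [y1, y2, y3, y4]) (\<tau> y3))) ?bad"
    proof (rule prob_bind_lower)
      fix y3 assume "y3 \<in> set_pmf (\<tau> y2)" "y3 \<in> - ?L i"
      then show "?r ^ i \<le> measure_pmf.prob (map_pmf (\<lambda>y4. xs @ [y1, y2, y3, y4]) (\<tau> y3)) ?bad"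
        using at_step_Suc[OF y2] by (intro pay[OF y1]) (auto simp: numeral_eq_Suc)
    qed (use r in auto)
    finally show ?thesis .
  qed
  have forget: "1 / 2 * ?r ^ i \<le> measure_pmf.prob (bind_pmf (\<tau> y1) (\<lambda>y2. bind_pmf (\<tau> y2) (\<lambda>y3.
      map_pmf (\<lambda>y4. xs @ [y1, y2, y3, y4]) (\<tau> y3)))) ?bad"
    if y1: "label (snd y1) = i" "y1 \<in> at_step (4 * n + 1)" for y1
  proof -
    \<comment> \<open>The mode may still be updated here, but \<open>i\<close> serves every mode, so
      the bound is passed on with probability 1.\<close>
    have "measure_pmf.prob (\<tau> y1) UNIV * (1 / 2 * ?r ^ i) \<le>
        measure_pmf.prob (bind_pmf (\<tau> y1) (\<lambda>y2. bind_pmf (\<tau> y2) (\<lambda>y3.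
          map_pmf (\<lambda>y4. xs @ [y1, y2, y3, y4]) (\<tau> y3)))) ?bad"
    proof (rule prob_bind_lower)
      fix y2 assume "y2 \<in> set_pmf (\<tau> y1)"
      then show "1 / 2 * ?r ^ i \<le> measure_pmf.prob (bind_pmf (\<tau> y2) (\<lambda>y3.
          map_pmf (\<lambda>y4. xs @ [y1, y2, y3, y4]) (\<tau> y3))) ?bad"
        using at_step_Suc[OF y1(2)] by (intro choose[OF y1(1)]) (simp add: numeral_eq_Suc)
    qed (use r in auto)
    then show ?thesis by simp
  qed
  have d: "depth (snd (last xs)) = 4 * n" using last by (auto simp: at_step_def)
  have "?r ^ (?N - i) / 2 \<le> pmf (token ?r ?N) i" by (rule token_lower) (use r i in auto)
  also have "\<dots> = measure_pmf.prob (tprob game (snd (last xs))) {s'. label s' = i}"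
    unfolding tprob_game(1)[OF d] measure_map_pmf measure_pmf_single[symmetric]
    by (rule arg_cong[where f="measure_pmf.prob _"]) auto
  also have "\<dots> = measure_pmf.prob (\<tau> (last xs)) (?L i)"
    using prob_label_rand[of "fst (last xs)" "snd (last xs)" "4 * n" i] last by simp
  finally have receive: "?r ^ (?N - i) / 2 \<le> measure_pmf.prob (\<tau> (last xs)) (?L i)" .
  \<comment> \<open>The dependence on \<open>i\<close> cancels: \<open>?r ^ (?N - i)\<close> for
    receiving \<open>i\<close> meets \<open>?r ^ i\<close> for the wrong payment.\<close>
  have "?r ^ ?N / 4 = ?r ^ (?N - i) / 2 * (1 / 2 * ?r ^ i)"
    using i(1) by (simp flip: power_add)
  also have "\<dots> \<le> measure_pmf.prob (\<tau> (last xs)) (?L i) * (1 / 2 * ?r ^ i)"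
    using r by (intro mult_right_mono receive) auto
  also have "\<dots> \<le> measure_pmf.prob (play_round xs) ?bad"
    unfolding play_round_def
  proof (rule prob_bind_lower)
    fix y1 assume "y1 \<in> set_pmf (\<tau> (last xs))" "y1 \<in> ?L i"
    then show "1 / 2 * ?r ^ i \<le> measure_pmf.prob (bind_pmf (\<tau> y1) (\<lambda>y2. bind_pmf (\<tau> y2) (\<lambda>y3.
        map_pmf (\<lambda>y4. xs @ [y1, y2, y3, y4]) (\<tau> y3)))) ?bad"
      using at_step_Suc[OF last] by (intro forget) auto
  qed (use r in auto)
  finally show ?thesis .
qed

text \<open>The bound on a bad round holds after every possible history, so the factors multiply as
  if the rounds were independent.\<close>

lemma prob_good_rounds:
  assumes m0: "(m0, start) \<in> at_step 0" and "m \<le> n"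
  shows "measure_pmf.prob (chain_prefix \<tau> (m0, start) (4 * n)) {xs. \<forall>k\<in>{m..<n}. good k xs} \<le>
    (\<Prod>k=m..<n. 1 - forced_cost K k)"
  using \<open>m \<le> n\<close>
proof (induction n rule: dec_induct)
  case base
  then show ?case by simp
next
  case (step n)
  let ?C = "chain_prefix \<tau> (m0, start)"
  let ?G = "\<lambda>n. {xs. \<forall>k\<in>{m..<n}. good k xs}"
  have round_good: "good k ys \<longleftrightarrow> good k xs"
    if xs: "xs \<in> set_pmf (?C (4 * n))" and ys: "ys \<in> set_pmf (play_round xs)" and "k < n" for xs ys k
  proof -
    obtain zs where "ys = xs @ zs" using ys by (auto simp: play_round_def)
    then show ?thesis using good_append[of k xs] length_chain_prefix[OF xs] \<open>k < n\<close> by simp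
  qed
  have "measure_pmf.prob (?C (4 * Suc n)) (?G (Suc n)) \<le>
      measure_pmf.prob (?C (4 * n)) (?G n) * (1 - forced_cost K n)"
    unfolding chain_prefix_round
  proof (rule prob_bind_upper)
    fix xs assume xs: "xs \<in> set_pmf (?C (4 * n))" "xs \<in> ?G n"
    have "forced_cost K n \<le> measure_pmf.prob (play_round xs) {ys. \<not> good n ys}"
      using prob_bad_round[of xs n] length_chain_prefix[OF xs(1)] last_chain_prefix[OF m0 xs(1)]
      by (simp add: forced_cost_def)
    moreover have "measure_pmf.prob (play_round xs) (?G (Suc n)) \<le>
        measure_pmf.prob (play_round xs) (UNIV - {ys. \<not> good n ys})"
      using step.hyps by (intro measure_pmf.finite_measure_mono) auto
    ultimately show "measure_pmf.prob (play_round xs) (?G (Suc n)) \<le> 1 - forced_cost K n"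
      using measure_pmf.prob_compl[of "{ys. \<not> good n ys}" "play_round xs"] by simp
  next
    fix xs assume xs: "xs \<in> set_pmf (?C (4 * n))" "xs \<notin> ?G n"
    then have "set_pmf (play_round xs) \<inter> ?G (Suc n) = {}" using round_good[OF xs(1)] by fastforce
    then show "measure_pmf.prob (play_round xs) (?G (Suc n)) = 0"
      by (simp add: measure_pmf_zero_iff)
  qed (simp add: forced_cost_bounds)
  also have "\<dots> \<le> (\<Prod>k=m..<n. 1 - forced_cost K k) * (1 - forced_cost K n)"
    by (intro mult_right_mono step.IH) (simp add: forced_cost_bounds)
  also have "\<dots> = (\<Prod>k=m..<Suc n. 1 - forced_cost K k)"
    using step.hyps by simp
  finally show ?case .
qed

lemma bounded_memory_loses:
  assumes strat: "strategy game \<sigma>" and m0: "m0 \<in> R 0"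
    and impl: "implemented_by game start \<tau> m0 \<sigma>"
  shows "measure (run_measure game start \<sigma>) (TP_liminf_ge_0 game) = 0"
proof -
  let ?P = "run_measure game start \<sigma>"
  interpret P: prob_space ?P by (rule prob_space_run_measure)
  have start_state: "start \<in> states game" by (simp add: start_def states_game)
  have m0': "(m0, start) \<in> at_step 0" using m0 start_state by (simp add: at_step_def start_def)
  have never: "AE \<omega> in ?P. \<not> (\<forall>n\<ge>m. good_round n \<omega>)" for m
  proof -
    \<comment> \<open>The first \<open>4 * n + 1\<close> states contain all rounds below
      \<open>n\<close>, so this superset of the event in question is decided by a finite
      prefix.\<close>
    let ?E = "\<lambda>n. {\<omega>. \<forall>k\<in>{m..<n}. good_round k (\<lambda>t. map \<omega> [0..<Suc (4 * n)] ! t)}"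
    have E_sets: "?E n \<in> sets ?P" for n
      by (rule measurable_run_prefix)
    have subset: "{\<omega>. \<forall>n\<ge>m. good_round n \<omega>} \<subseteq> ?E n" for n
      by (auto simp: good_round_def simp del: upt_Suc)
    have E_le: "P.prob (?E n) \<le> (\<Prod>k=m..<n. 1 - forced_cost K k)" if "m \<le> n" for n
    proof -
      have "P.prob (?E n) = measure_pmf.prob (run_prefix game start \<sigma> (4 * n))
          {h. \<forall>k\<in>{m..<n}. good_round k (\<lambda>t. h ! t)}"
        by (rule measure_run_prefix)
      also have "\<dots> = measure_pmf.prob (chain_prefix \<tau> (m0, start) (4 * n)) {xs. \<forall>k\<in>{m..<n}. good k xs}"
        using R_subset m0
        by (subst MDP.run_prefix_implemented_by[OF MDP_game memory _ start_state impl])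
          (auto simp: good_def vimage_def)
      finally show ?thesis using prob_good_rounds[OF m0' that] by simp
    qed
    have "(\<lambda>n. P.prob (?E n)) \<longlonglongrightarrow> 0"
    proof (rule tendsto_sandwich[OF _ _ tendsto_const])
      show "(\<lambda>n. \<Prod>k=m..<n. 1 - forced_cost K k) \<longlonglongrightarrow> 0"
        by (intro prod_one_minus_tendsto_0 forced_cost_bounds not_summable_forced_cost)
      show "eventually (\<lambda>n. P.prob (?E n) \<le> (\<Prod>k=m..<n. 1 - forced_cost K k)) sequentially"
        using E_le by (auto simp: eventually_sequentially)
    qed simp
    moreover have "P.prob (\<Inter>n. ?E n) \<le> P.prob (?E n)" for n
      using E_sets by (intro P.finite_measure_mono) auto
    ultimately have "P.prob (\<Inter>n. ?E n) \<le> 0"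
      by (intro LIMSEQ_le_const) auto
    then have "(\<Inter>n. ?E n) \<in> null_sets ?P"
      using E_sets by (intro null_setsI) (auto simp: P.emeasure_eq_measure measure_le_0_iff)
    moreover have "{\<omega>. \<forall>n\<ge>m. good_round n \<omega>} \<subseteq> (\<Inter>n. ?E n)"
      using subset by blast
    ultimately show ?thesis
      by (intro AE_I'[of "\<Inter>n. ?E n"]) (simp_all add: space_run_measure del: upt_Suc)
  qed
  have "AE \<omega> in ?P. \<forall>m. \<not> (\<forall>n\<ge>m. good_round n \<omega>)"
    by (intro AE_all_countable[THEN iffD2] allI never)
  with AE_run_path[OF MDP_game strat start_state]
  have "AE \<omega> in ?P. \<omega> \<notin> TP_liminf_ge_0 game"
  proof eventually_elim
    case (elim \<omega>)
    then show ?case using eventually_good_round[of \<omega>] by (auto simp: is_path_def)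
  qed
  then show ?thesis using P.prob_eq_0[OF sets_TP_liminf_ge_0] by simp
qed

end

section \<open>Finite memory, and k bits beside a step counter, as instances\<close>

lemma FR_strategy_loses:
  assumes "FR_strategy game start \<sigma>"
  shows "measure (run_measure game start \<sigma>) (TP_liminf_ge_0 game) = 0"
proof -
  obtain Q :: "nat set" and \<tau> m0 where *: "strategy game \<sigma>" "finite Q" "m0 \<in> Q"
    "memory_structure game Q \<tau>" "implemented_by game start \<tau> m0 \<sigma>"
    using assms by (auto simp: FR_strategy_def)
  interpret bounded_memory Q \<tau> "\<lambda>_. Q" "card Q"
  proof
    show "m' \<in> Q" if "m \<in> Q" "s \<in> states game" "(m', s') \<in> set_pmf (\<tau> (m, s))" for m s m' s'
      using MDP.memory_step(1)[OF MDP_game *(4) that] .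
  qed (use * in auto)
  show ?thesis using * by (intro bounded_memory_loses)
qed

lemma kbit_Markov_strategy_loses:
  assumes "kbit_Markov_strategy k game start \<sigma>"
  shows "measure (run_measure game start \<sigma>) (TP_liminf_ge_0 game) = 0"
proof -
  let ?B = "{b :: bool list. length b = k}"
  obtain \<tau> b0 where *: "strategy game \<sigma>" "length b0 = k"
    "memory_structure game (UNIV \<times> ?B) \<tau>" "implemented_by game start \<tau> (0, b0) \<sigma>"
    and step: "\<forall>n b. length b = k \<longrightarrow>
      (\<forall>s \<in> states game. \<forall>((n', b'), s') \<in> set_pmf (\<tau> ((n, b), s)). n' = Suc n)"
    using assms unfolding kbit_Markov_strategy_def by (elim conjE exE)
  have counter: "n' = Suc n"
    if "length b = k" "s \<in> states game" "((n', b'), s') \<in> set_pmf (\<tau> ((n, b), s))" for n b s n' b' s'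
    using step[rule_format, OF that] by simp
  have finite: "finite ?B"
    using finite_lists_length_eq[of "UNIV :: bool set" k] by simp
  \<comment> \<open>At step \<open>t\<close> the counter equals \<open>t\<close>, so of the
    infinitely many modes only as many are possible as there are bit strings of length
    \<open>k\<close>.\<close>
  interpret bounded_memory "UNIV \<times> ?B" \<tau> "\<lambda>t. {t} \<times> ?B" "card ?B"
  proof
    show "m' \<in> {Suc (depth s)} \<times> ?B"
      if "m \<in> {depth s} \<times> ?B" "s \<in> states game" "(m', s') \<in> set_pmf (\<tau> (m, s))" for m s m' s'
      using MDP.memory_step(1)[OF MDP_game *(3) _ that(2,3)] that
        counter[of "snd m" s "fst m'" "snd m'" s' "fst m"] by auto
  qed (use * finite in auto)
  show ?thesis using * by (intro bounded_memory_loses) auto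
qed


section \<open>The winning strategy\<close>

text \<open>The state before the last one shows the amount received. The minimum makes the choice a
  legal successor without any look at the history.\<close>

definition matching :: "nat list \<Rightarrow> nat pmf" where
  "matching h = (let t = Suc (depth (last h)) in
     return_pmf (node t (min (label (h ! (length h - 2))) (width t))))"

lemma strategy_matching: "strategy game matching"
  by (auto simp: strategy_def matching_def Let_def succs_game states_def)

lemma next_dist_matching_ctrl:
  assumes "length h = 4 * n + 3" "depth (last h) = 4 * n + 2" "label (last h) = 0"
    and "label (h ! (4 * n + 1)) \<le> level n"
  shows "next_dist game start matching h = return_pmf (node (4 * n + 3) (label (h ! (4 * n + 1))))"
proof -
  have "(4 * n + 2) mod 4 = 2" by presburger
  then have "last h \<in> ctrl game" using assms by (simp add: ctrl_game)
  then show ?thesis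
    using assms width_simps(4)[of n]
    by (auto simp: next_dist_def matching_def numeral_eq_Suc min_absorb1)
qed

lemma next_dist_rand: "h \<noteq> [] \<Longrightarrow> depth (last h) mod 4 \<noteq> 2 \<Longrightarrow> next_dist game start \<sigma> h = tprob game (last h)"
  by (auto simp: next_dist_def ctrl_game)

text \<open>The payment equals the amount \<open>i\<close>, so the loss has probability
  \<open>rate n ^ (i + 1)\<close> after every history, and \<open>token_cost_upper\<close> averages
  this over \<open>i\<close>.\<close>

lemma prob_loss_matching:
  "measure_pmf.prob (run_prefix game start matching (4 * n + 4)) {h. label (h ! (4 * n + 4)) \<noteq> 0} \<le>
    real (level n + 1) * rate n ^ (level n + 1)"
proof -
  let ?P = "run_prefix game start matching" and ?D = "next_dist game start matching"
  let ?loss = "{h. label (h ! (4 * n + 4)) \<noteq> 0}"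
  define f where "f h = bind_pmf (?D h) (\<lambda>s1. bind_pmf (?D (h @ [s1])) (\<lambda>s2.
     bind_pmf (?D (h @ [s1, s2])) (\<lambda>s3. map_pmf (\<lambda>s4. h @ [s1, s2, s3, s4]) (?D (h @ [s1, s2, s3])))))" for h
  have "?P (4 * n + 4) = bind_pmf (?P (4 * n)) f"
    by (simp add: f_def[abs_def] bind_assoc_pmf bind_map_pmf map_bind_pmf eval_nat_numeral)
  moreover have "measure_pmf.prob (bind_pmf (?P (4 * n)) f) ?loss \<le>
      measure_pmf.prob (?P (4 * n)) UNIV * (real (level n + 1) * rate n ^ (level n + 1))"
  proof (rule prob_bind_upper)
    fix h assume h: "h \<in> set_pmf (?P (4 * n))"
    have len: "length h = 4 * n + 1" using length_run_prefix[OF h] by simp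
    have start: "start \<in> states game" by (simp add: start_def states_game)
    have d: "depth (last h) = 4 * n"
      using MDP.partial_run_run_prefix[OF MDP_game strategy_matching start h]
        depth_relpow[of start "last h" "4 * n"] by (simp add: start_def)
    have mods: "(4 * n) mod 4 \<noteq> 2" "(4 * n + 1) mod 4 \<noteq> 2" "(4 * n + 3) mod 4 \<noteq> 2"
      by presburger+
    have D0: "?D h = map_pmf (node (4 * n + 1)) (token (rate n) (level n))"
      using next_dist_rand[of h] d len mods tprob_game(1)[OF d] by fastforce
    have D1: "?D (h @ [node (4 * n + 1) i]) = return_pmf (node (4 * n + 2) 0)" for i
      using next_dist_rand[of "h @ [node (4 * n + 1) i]"] mods
        tprob_game(2)[of "node (4 * n + 1) i" n] by simp
    have D2: "?D (h @ [node (4 * n + 1) i, node (4 * n + 2) 0]) = return_pmf (node (4 * n + 3) i)"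
      if "i \<le> level n" for i
      using next_dist_matching_ctrl[of "h @ [node (4 * n + 1) i, node (4 * n + 2) 0]" n] len that
      by (simp add: nth_append)
    have D3: "?D (h @ [node (4 * n + 1) i, node (4 * n + 2) 0, node (4 * n + 3) i]) =
        map_pmf (\<lambda>b. node (4 * n + 4) (of_bool b)) (bernoulli_pmf (rate n ^ (i + 1)))" for i
      using next_dist_rand[of "h @ [node (4 * n + 1) i, node (4 * n + 2) 0, node (4 * n + 3) i]"] mods
        tprob_game(3)[of "node (4 * n + 3) i" n] by simp
    \<comment> \<open>Once \<open>i\<close> is drawn, forgetting and paying are deterministic, and
      only the loss is left to chance.\<close>
    define g where "g i = map_pmf (\<lambda>b. h @ [node (4 * n + 1) i, node (4 * n + 2) 0, node (4 * n + 3) i,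
        node (4 * n + 4) (of_bool b)]) (bernoulli_pmf (rate n ^ (i + 1)))" for i
    have "f h = bind_pmf (token (rate n) (level n)) g"
      unfolding f_def D0 bind_map_pmf
    proof (rule bind_pmf_cong[OF refl])
      fix i assume "i \<in> set_pmf (token (rate n) (level n))"
      then have "i \<le> level n" using set_token by auto
      then show "bind_pmf (?D (h @ [node (4 * n + 1) i])) (\<lambda>s2.
          bind_pmf (?D (h @ [node (4 * n + 1) i, s2])) (\<lambda>s3.
            map_pmf (\<lambda>s4. h @ [node (4 * n + 1) i, s2, s3, s4])
              (?D (h @ [node (4 * n + 1) i, s2, s3])))) = g i"
        unfolding D1 bind_return_pmf D2[OF \<open>i \<le> level n\<close>] D3
        by (simp add: g_def pmf.map_comp o_def)
    qed
    moreover have "measure_pmf.prob (g i) ?loss \<le> rate n ^ (i + 1)" for i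
    proof -
      have "measure_pmf.prob (g i) ?loss \<le> measure_pmf.prob (bernoulli_pmf (rate n ^ (i + 1))) {True}"
        unfolding g_def measure_map_pmf using len
        by (intro measure_pmf.finite_measure_mono) (auto simp: nth_append split: if_splits)
      then show ?thesis by (simp only: measure_pmf_single pmf_bernoulli_True rate_power_bounds)
    qed
    ultimately show "measure_pmf.prob (f h) ?loss \<le> real (level n + 1) * rate n ^ (level n + 1)"
      using token_cost_upper[OF rate_bounds(1,3), of "level n" g ?loss n] by simp
  qed (auto simp: rate_bounds)
  ultimately show ?thesis by simp
qed

text \<open>Loss probabilities are summable, so by Borel-Cantelli almost surely only finitely many
  losses occur, while payments always match.\<close>

lemma matching_wins: "measure (run_measure game start matching) (TP_liminf_ge_0 game) = 1"
proof -
  let ?P = "run_measure game start matching"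
  interpret P: prob_space ?P by (rule prob_space_run_measure)
  have start: "start \<in> states game" by (simp add: start_def states_game)
  \<comment> \<open>Written through a prefix, so that \<open>measurable_run_prefix\<close> and
    \<open>measure_run_prefix\<close> apply.\<close>
  define loss where "loss n = {\<omega>. label (map \<omega> [0..<Suc (4 * n + 4)] ! (4 * n + 4)) \<noteq> 0}" for n
  have loss_eq: "loss n = {\<omega>. label (\<omega> (4 * n + 4)) \<noteq> 0}" for n
    by (simp add: loss_def del: upt_Suc)
  have "AE \<omega> in ?P. eventually (\<lambda>n. \<omega> \<in> space ?P - loss n) sequentially"
  proof (rule borel_cantelli_AE1)
    show "loss n \<in> sets ?P" for n
      unfolding loss_def by (rule measurable_run_prefix)
    show "emeasure ?P (loss n) < \<infinity>" for n
      by (simp add: P.emeasure_eq_measure)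
    show "summable (\<lambda>n. P.prob (loss n))"
    proof (rule summable_comparison_test'[OF summable_matched_cost])
      show "norm (P.prob (loss n)) \<le> real (level n + 1) * rate n ^ (level n + 1)" for n
        using prob_loss_matching[of n]
          measure_run_prefix[of game start matching "\<lambda>h. label (h ! (4 * n + 4)) \<noteq> 0" "4 * n + 4"]
        by (simp add: loss_def del: upt_Suc)
    qed
  qed
  with AE_run_step[where M=game and \<sigma>=matching] AE_run_path[OF MDP_game strategy_matching start]
  have "AE \<omega> in ?P. \<omega> \<in> TP_liminf_ge_0 game"
  proof eventually_elim
    case (elim \<omega>)
    then have path: "is_path \<omega>" by (simp add: is_path_def)
    have "label (\<omega> (4 * n + 3)) = label (\<omega> (4 * n + 1))" for n
    proof -
      let ?h = "map \<omega> [0..<Suc (4 * n + 2)]"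
      have "last ?h = \<omega> (4 * n + 2)" "?h ! (4 * n + 1) = \<omega> (4 * n + 1)"
        by (simp, simp del: upt_Suc)
      moreover have "label (\<omega> (4 * n + 2)) = 0"
        using label_path[OF path, of "4 * n + 2"] unfolding width_simps by simp
      ultimately have "next_dist game start matching ?h = return_pmf (node (4 * n + 3) (label (\<omega> (4 * n + 1))))"
        using next_dist_matching_ctrl[of ?h n] depth_path[OF path]
          label_path[OF path, of "4 * n + 1"]
        by (simp del: upt_Suc)
      moreover have "\<omega> (Suc (4 * n + 2)) \<in> set_pmf (next_dist game start matching ?h)"
        using elim(1) by blast
      ultimately have "\<omega> (4 * n + 3) = node (4 * n + 3) (label (\<omega> (4 * n + 1)))"
        by (simp add: numeral_eq_Suc)
      then show ?thesis by simp
    qed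
    moreover have "eventually (\<lambda>n. label (\<omega> (4 * n + 4)) = 0) sequentially"
      using elim(3) by (simp add: loss_eq space_run_measure)
    ultimately show ?case by (intro matched_in_TP path)
  qed
  then show ?thesis using P.prob_eq_1[OF sets_TP_liminf_ge_0] by simp
qed

theorem theorem5p8:
  "\<exists>(M :: nat mdp) s0.
     MDP M \<and> s0 \<in> states M \<and>
     finitely_branching M \<and> acyclic_mdp M \<and> integer_rewards M \<and> step_counter_implicit M s0 \<and>
     (\<exists>\<sigma>. strategy M \<sigma> \<and> measure (run_measure M s0 \<sigma>) (TP_liminf_ge_0 M) = 1) \<and>
     (\<forall>\<sigma>. FR_strategy M s0 \<sigma> \<longrightarrow> measure (run_measure M s0 \<sigma>) (TP_liminf_ge_0 M) = 0) \<and>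
     (\<forall>k \<sigma>. kbit_Markov_strategy k M s0 \<sigma> \<longrightarrow>
        measure (run_measure M s0 \<sigma>) (TP_liminf_ge_0 M) \<noteq> 1)"
proof (intro exI[of _ game] exI[of _ start] conjI allI impI)
  show "start \<in> states game" by (simp add: start_def states_game)
  show "\<exists>\<sigma>. strategy game \<sigma> \<and> measure (run_measure game start \<sigma>) (TP_liminf_ge_0 game) = 1"
    using strategy_matching matching_wins by blast
  show "measure (run_measure game start \<sigma>) (TP_liminf_ge_0 game) = 0"
    if "FR_strategy game start \<sigma>" for \<sigma>
    using that by (rule FR_strategy_loses)
  show "measure (run_measure game start \<sigma>) (TP_liminf_ge_0 game) \<noteq> 1"
    if "kbit_Markov_strategy k game start \<sigma>" for k \<sigma>
    using kbit_Markov_strategy_loses[OF that] by simp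
qed (rule MDP_game finitely_branching_game acyclic_game integer_rewards_game step_counter_implicit_game)+

end
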